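(* Let $N\ge2$, $\rho>0$, let $n_0<\cdots<n_{N-1}<M$ be real numbers, and let the set of matrices $\mathcal{P}_0$, together with these exponents, be as in one of the settings (1)--(3) described in the context. Let $c_0,\ldots,c_{N-1}>0$, let $$\mathcal{C}:=\sum_{j=0}^{N-1}\frac{V(\mathbf{n}_j)^2}{V(\mathbf{n})^2}\frac{\rho^{M-n_j}}{c_j},\qquad \mathbf{n}:=(n_0,\ldots,n_{N-1}),\quad \mathbf{n}_j:=(n_0,\ldots,\widehat{n_j},\ldots,n_{N-1},M),$$ let $c'>-\mathcal{C}^{-1}$ be real, and set $$h(z)=\sum_{j=0}^{N-1}c_jz^{n_j},\qquad f(z)=h(z)+c'z^M,\qquad g(z)=h(z)-\mathcal{C}^{-1}z^M.$$ Let $A\in\mathcal{P}_0$ and suppose $n_0=0$ if $A$ has a zero row. Then $$\operatorname{rank}f[A]=\operatorname{rank}h[A]=|\pi(A)|,$$ while $\operatorname{rank}g[A]=|\pi(A)|$ if (a) $A\notin\mathcal{S}_{\pi_\vee}$, or (b) $A\in\mathcal{S}_{\pi_\vee}$ and $A$ has a row with distinct entries, with $n_0=0$ if any entry in this row is zero.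
   Context: For $I\subseteq\mathbb{C}$ and positive integers $k\le N$, $\mathcal{P}_N^k(I)$ is the set of positive semidefinite (hence Hermitian) $N\times N$ matrices with entries in $I$ and rank at most $k$, and $\mathcal{P}_N(I):=\mathcal{P}_N^N(I)$. $\mathbb{Z}_+$ is the set of non-negative integers. $f[A]:=(f(a_{ij}))$ is the entrywise action, with $0^0:=1$. In $\mathbf{n}_j$, $\widehat{n_j}$ indicates that $n_j$ is omitted. For $\mathbf{m}=(m_1,\ldots,m_N)$, $V(\mathbf{m}):=\prod_{1\le k<l\le N}(m_l-m_k)$. Settings: (1) $\mathcal{P}_0=\mathcal{P}_N^1((0,\rho))$, with $n_0,\ldots,n_{N-1},M$ arbitrary real numbers. (2) $\mathcal{P}_N^1((0,\rho))\subseteq\mathcal{P}_0\subseteq\mathcal{P}_N^1([0,\rho])$, with $n_0,\ldots,n_{N-1},M$ non-negative real numbers. (3) $\mathcal{P}_N^1((0,\rho))\subseteq\mathcal{P}_0\subseteq\mathcal{P}_N([0,\rho])$, with $n_0,\ldots,n_{N-1},M\in\mathbb{Z}_+\cup[N-1,\infty)$. $(\Pi_N,\preccurlyeq)$ is the poset of partitions of $\{1,\ldots,N\}$, with $\pi'\preccurlyeq\pi$ if and only if $\pi$ is a refinement of $\pi'$ (every set in $\pi$ is a subset of some set in $\pi'$); $|\pi|$ is the number of sets in $\pi$. For a complex $N\times N$ matrix $A$, $\pi(A)$ is the unique minimal (that is, coarsest) partition $\pi\in\Pi_N$ such that, for all $I,J\in\pi$, the submatrix $A_{I\times J}$ (rows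 in $I$, columns in $J$) has all its entries equal. The stratum of $\pi\in\Pi_N$ is $\mathcal{S}_\pi:=\{A\in\mathbb{C}^{N\times N}:\pi(A)=\pi\}$. $\pi_\vee:=\{\{1\},\ldots,\{N\}\}$. *)

theory Defs
  imports
    "HOL-Library.Disjoint_Sets"
    "HOL-Analysis.Complex_Transcendental"
    "Jordan_Normal_Form.Schur_Decomposition"
    "Jordan_Normal_Form.DL_Rank"
begin

text \<open>Rows, columns and tuples of length \<open>N\<close> are indexed by \<open>{..<N}\<close> throughout.\<close>

text \<open>The order on \<^typ>\<open>complex\<close> is that of \<^theory>\<open>HOL-Library.Complex_Order\<close>:
  \<open>0 \<le> z\<close> says that \<open>z\<close> is real and non-negative.\<close>

definition positive_semidefinite :: "nat \<Rightarrow> complex mat \<Rightarrow> bool" where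
  "positive_semidefinite N A \<longleftrightarrow>
     A \<in> carrier_mat N N \<and> mat_adjoint A = A \<and>
     (\<forall>v \<in> carrier_vec N. 0 \<le> (A *\<^sub>v v) \<bullet>c v)"

definition psd_mats :: "nat \<Rightarrow> nat \<Rightarrow> complex set \<Rightarrow> complex mat set" where
  "psd_mats N k I = {A. positive_semidefinite N A \<and> elements_mat A \<subseteq> I \<and> vec_space.rank N A \<le> k}"

text \<open>The library has \<open>0 powr 0 = 0\<close>; here \<open>0\<^sup>0 = 1\<close>.  On \<open>z = complex_of_real x\<close>
  with \<open>x > 0\<close> this is the usual real power.\<close>

definition rpow :: "complex \<Rightarrow> real \<Rightarrow> complex" where
  "rpow z a = (if a = 0 then 1 else z powr complex_of_real a)"

definition V :: "real list \<Rightarrow> real" where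
  "V m = (\<Prod>l<length m. \<Prod>k<l. m ! l - m ! k)"

definition omit_append :: "nat \<Rightarrow> (nat \<Rightarrow> real) \<Rightarrow> real \<Rightarrow> nat \<Rightarrow> real list" where
  "omit_append N n M j = map n (filter (\<lambda>i. i \<noteq> j) [0..<N]) @ [M]"

definition threshold :: "nat \<Rightarrow> real \<Rightarrow> (nat \<Rightarrow> real) \<Rightarrow> real \<Rightarrow> (nat \<Rightarrow> real) \<Rightarrow> real" where
  "threshold N \<rho> n M c =
     (\<Sum>j<N. (V (omit_append N n M j))\<^sup>2 / (V (map n [0..<N]))\<^sup>2 * (\<rho> powr (M - n j) / c j))"

definition setting1 :: "nat \<Rightarrow> real \<Rightarrow> (nat \<Rightarrow> real) \<Rightarrow> real \<Rightarrow> complex mat set \<Rightarrow> bool" where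
  "setting1 N \<rho> n M P \<longleftrightarrow> P = psd_mats N 1 (complex_of_real ` {0<..<\<rho>})"

definition setting2 :: "nat \<Rightarrow> real \<Rightarrow> (nat \<Rightarrow> real) \<Rightarrow> real \<Rightarrow> complex mat set \<Rightarrow> bool" where
  "setting2 N \<rho> n M P \<longleftrightarrow>
     psd_mats N 1 (complex_of_real ` {0<..<\<rho>}) \<subseteq> P \<and>
     P \<subseteq> psd_mats N 1 (complex_of_real ` {0..\<rho>}) \<and>
     (\<forall>j<N. 0 \<le> n j) \<and> 0 \<le> M"

definition setting3 :: "nat \<Rightarrow> real \<Rightarrow> (nat \<Rightarrow> real) \<Rightarrow> real \<Rightarrow> complex mat set \<Rightarrow> bool" where
  "setting3 N \<rho> n M P \<longleftrightarrow>
     psd_mats N 1 (complex_of_real ` {0<..<\<rho>}) \<subseteq> P \<and>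
     P \<subseteq> psd_mats N N (complex_of_real ` {0..\<rho>}) \<and>
     (\<forall>j<N. n j \<in> \<nat> \<union> {real N - 1..}) \<and> M \<in> \<nat> \<union> {real N - 1..}"

text \<open>The library's \<open>refines X P Q\<close> says that \<open>P\<close> is finer than \<open>Q\<close>; in the partial order
  below the coarser partition is the smaller one.\<close>

definition part_le :: "nat \<Rightarrow> nat set set \<Rightarrow> nat set set \<Rightarrow> bool" where
  "part_le N p' p \<longleftrightarrow> refines {..<N} p p'"

definition block_constant :: "nat \<Rightarrow> complex mat \<Rightarrow> nat set set \<Rightarrow> bool" where
  "block_constant N A p \<longleftrightarrow> partition_on {..<N} p \<and>
     (\<forall>I\<in>p. \<forall>J\<in>p. \<forall>i\<in>I. \<forall>i'\<in>I. \<forall>j\<in>J. \<forall>j'\<in>J. A $$ (i, j) = A $$ (i', j'))"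

definition minimal_block_constant :: "nat \<Rightarrow> complex mat \<Rightarrow> nat set set \<Rightarrow> bool" where
  "minimal_block_constant N A p \<longleftrightarrow> block_constant N A p \<and>
     (\<forall>q. block_constant N A q \<and> part_le N q p \<longrightarrow> q = p)"

definition partition_of :: "nat \<Rightarrow> complex mat \<Rightarrow> nat set set" where
  "partition_of N A = (THE p. minimal_block_constant N A p)"

definition stratum :: "nat \<Rightarrow> nat set set \<Rightarrow> complex mat set" where
  "stratum N p = {A \<in> carrier_mat N N. partition_of N A = p}"

definition singletons :: "nat \<Rightarrow> nat set set" where
  "singletons N = (\<lambda>i. {i}) ` {..<N}"

text \<open>The description operator in \<^const>\<open>partition_of\<close> is well defined: the minimal partition
  exists, is unique, and is in fact the least one.\<close>

lemma least_block_constant: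
  "\<exists>p. block_constant N A p \<and> (\<forall>q. block_constant N A q \<longrightarrow> part_le N p q)"
proof -
  define r where "r = {(i, i'). i < N \<and> i' < N \<and>
    (\<forall>k<N. A $$ (i, k) = A $$ (i', k) \<and> A $$ (k, i) = A $$ (k, i'))}"
  have eq: "equiv {..<N} r"
    unfolding equiv_def refl_on_def sym_def trans_def r_def by auto
  define p where "p = {..<N} // r"
  have part: "partition_on {..<N} p"
    unfolding p_def by (rule partition_on_quotient[OF eq])
  have rel: "(i, i') \<in> r" if "I \<in> p" "i \<in> I" "i' \<in> I" for I i i'
    using that quotient_eq_iff[OF eq] unfolding p_def by blast
  have "A $$ (i, j) = A $$ (i', j')"
    if "I \<in> p" "J \<in> p" "i \<in> I" "i' \<in> I" "j \<in> J" "j' \<in> J" for I J i i' j j'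
    using rel[of I i i'] rel[of J j j'] that by (auto simp: r_def)
  with part have bc: "block_constant N A p"
    unfolding block_constant_def by blast
  have "part_le N p q" if q: "block_constant N A q" for q
  proof -
    have pq: "partition_on {..<N} q" using q by (simp add: block_constant_def)
    have "\<exists>Y\<in>p. X \<subseteq> Y" if X: "X \<in> q" for X
    proof -
      have "X \<noteq> {}" and XN: "X \<subseteq> {..<N}" using pq X by (auto simp: partition_on_def)
      then obtain i where i: "i \<in> X" by blast
      have "(i, i') \<in> r" if i': "i' \<in> X" for i'
      proof -
        have "A $$ (i, k) = A $$ (i', k) \<and> A $$ (k, i) = A $$ (k, i')" if "k < N" for k
        proof -
          have "k \<in> \<Union>q" using pq that by (simp add: partition_on_def)
          then obtain K where "K \<in> q" "k \<in> K" by blast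
          then show ?thesis using q X i i' unfolding block_constant_def by blast
        qed
        then show ?thesis using XN i i' by (auto simp: r_def)
      qed
      then have "X \<subseteq> r `` {i}" by blast
      moreover have "r `` {i} \<in> p" using i XN unfolding p_def by (auto intro: quotientI)
      ultimately show ?thesis by blast
    qed
    then show ?thesis using part pq by (auto simp: part_le_def refines_def)
  qed
  with bc show ?thesis by blast
qed

lemma ex1_minimal_block_constant: "\<exists>!p. minimal_block_constant N A p"
proof -
  obtain p where p: "block_constant N A p" "\<And>q. block_constant N A q \<Longrightarrow> part_le N p q"
    using least_block_constant by blast
  show ?thesis
  proof (rule ex1I[of _ p])
    show "minimal_block_constant N A p"
      using p unfolding minimal_block_constant_def part_le_def by (metis refines_asym)
    show "q = p" if "minimal_block_constant N A q" for q
      using p that unfolding minimal_block_constant_def by metis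
  qed
qed

lemma minimal_partition_of: "minimal_block_constant N A (partition_of N A)"
  unfolding partition_of_def by (rule theI'[OF ex1_minimal_block_constant])

end

theory Submission
  imports Defs "Jordan_Normal_Form.DL_Rank_Submatrix"
begin

text \<open>The upper bound on each rank is immediate: an entrywise image has at most one distinct column
  per block of \<^term>\<open>partition_of N A\<close>. For the lower bound, let \<open>R\<close> contain one index from each
  block. It suffices that the principal submatrix of the image on \<open>R\<close> is positive definite, which
  is a statement about real quadratic forms.

  For \<open>h\<close>, the form is a positive combination of the forms of the entrywise powers of \<open>A\<close>, each of
  which is positive semidefinite (obvious in rank one; otherwise the theorem of FitzGerald and Horn,
  \<open>psd_power\<close>). A null vector \<open>v\<close> is thus killed by all \<open>N\<close> powers. If \<open>i\<close> has the largest diagonal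
  entry among the indices with \<open>v i \<noteq> 0\<close>, then positivity of the \<open>2 \<times> 2\<close> minors shows that this entry
  occurs only once in row \<open>i\<close>, and nonsingularity of generalised Vandermonde matrices gives
  \<open>v i = 0\<close>, a contradiction (\<open>common_kernel_trivial\<close>).

  For \<open>f\<close> and \<open>g\<close> one needs the sharp inequality that \<open>\<C>\<close> times the form of \<open>h\<close> dominates
  the form of \<open>z\<^sup>M\<close>, due to Khare and Tao (\<open>fewnomial_psd\<close>). For a rank one matrix with entries
  \<open>u i * u k\<close>, interpolate \<open>x\<^sup>M\<close> by the powers \<open>x\<^bsup>n j\<^esup>\<close> at the points \<open>u k\<close> and apply the
  Cauchy-Schwarz inequality; what is needed is a sharp bound on the interpolation coefficients.
  That bound follows by induction from Rolle's theorem: dividing by one of the powers and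
  differentiating removes one term and one node, and multiplies the other coefficients by
  exactly the expected factor (\<open>exp_interpolation_bound\<close>). In
  general \<open>A\<close> is compared with the rank one matrix built from its \<open>i\<close>-th row: along the
  segment that joins them the form has derivative at least zero, because the derivative is a Schur
  product of a Schur complement with the entrywise image of a matrix with one row less, under a function of the
  same kind with one power less and a smaller constant (\<open>entrywise_ge_rank_one\<close>).

  The form of \<open>f\<close> therefore dominates a positive multiple of that of \<open>h\<close>. So does the form of \<open>g\<close>
  when \<open>R\<close> has fewer than \<open>N\<close> elements, since then the powers other than the lowest suffice, with
  a constant strictly below \<open>\<C>\<close>. If \<open>R\<close> is everything, the form of \<open>g\<close> dominates that of its
  rank one comparison matrix for the given row with distinct entries, and there the interpolation
  bound is strict (\<open>fewnomial_form_definite\<close>).\<close>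

section \<open>Exponential polynomials on the real line\<close>

lemma Rolle_finite:
  fixes f f' :: "real \<Rightarrow> real"
  assumes "finite U" "card U = Suc m" "U \<subseteq> {l..r}" "\<And>x. x \<in> U \<Longrightarrow> f x = 0"
    and "\<And>x. (f has_real_derivative f' x) (at x)"
  shows "\<exists>W. finite W \<and> card W = m \<and> W \<subseteq> {l<..<r} \<and> (\<forall>x\<in>W. f' x = 0)"
  using assms(1-4)
proof (induction m arbitrary: U r)
  case 0
  show ?case by (rule exI[of _ "{}"]) auto
next
  case (Suc m)
  define b where "b = Max U"
  define U0 where "U0 = U - {b}"
  define b0 where "b0 = Max U0"
  have b: "b \<in> U" and bm: "\<And>x. x \<in> U \<Longrightarrow> x \<le> b"
    using Suc.prems unfolding b_def by (auto intro!: Max_in)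
  have U0: "finite U0" "card U0 = Suc m" using Suc.prems b by (auto simp: U0_def)
  then have b0: "b0 \<in> U0" and b0m: "\<And>x. x \<in> U0 \<Longrightarrow> x \<le> b0"
    unfolding b0_def by (auto intro!: Max_in)
  have lt: "b0 < b" using b0 bm unfolding U0_def by force
  have "\<exists>W. finite W \<and> card W = m \<and> W \<subseteq> {l<..<b0} \<and> (\<forall>x\<in>W. f' x = 0)"
    using Suc.prems U0 b0m by (intro Suc.IH[of U0]) (force simp: U0_def)+
  then obtain W where W: "finite W" "card W = m" "W \<subseteq> {l<..<b0}" "\<forall>x\<in>W. f' x = 0" by blast
  have "\<exists>z. b0 < z \<and> z < b \<and> DERIV f z :> 0"
  proof (rule Rolle[OF lt])
    show "f b0 = f b" using Suc.prems(4) b b0 by (auto simp: U0_def)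
    show "continuous_on {b0..b} f"
      using assms(5) by (meson DERIV_isCont continuous_at_imp_continuous_on)
    show "\<And>x. b0 < x \<Longrightarrow> x < b \<Longrightarrow> f differentiable (at x)"
      using assms(5) real_differentiable_def by blast
  qed
  then obtain z where z: "b0 < z" "z < b" "DERIV f z :> 0" by blast
  then have "f' z = 0" using assms(5) DERIV_unique by blast
  moreover have "l \<le> b0" "b \<le> r" using Suc.prems b b0 by (auto simp: U0_def)
  moreover have "z \<notin> W" using W z by auto
  ultimately show ?case using W z
    by (intro exI[of _ "insert z W"]) fastforce
qed

lemma exp_poly_deriv:
  fixes w l :: "'a \<Rightarrow> real"
  shows "((\<lambda>t. \<Sum>k\<in>K. w k * exp (l k * t)) has_real_derivative (\<Sum>k\<in>K. w k * l k * exp (l k * t))) (at t)"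
  by (auto intro!: derivative_eq_intros sum.cong)

text \<open>Multiplying by \<open>exp (- l j * t)\<close> makes the \<open>j\<close>-th term constant, so that by Rolle's theorem the
  derivative is an exponential polynomial with one term less and one zero less. This is
  the nonsingularity of generalised Vandermonde matrices, and it is used both with points as
  exponents and with exponents as points.\<close>

lemma exp_poly_zero:
  fixes w l :: "'a \<Rightarrow> real"
  assumes "finite K" "inj_on l K" "finite T" "card K \<le> card T"
    and "\<And>t. t \<in> T \<Longrightarrow> (\<Sum>k\<in>K. w k * exp (l k * t)) = 0" and "k \<in> K"
  shows "w k = 0"
  using assms
proof (induction "card K" arbitrary: K w l T k)
  case 0
  then show ?case by simp
next
  case (Suc m)
  have zero: "w k = 0" if kj: "k \<in> K - {j}" and j: "j \<in> K" for k j
  proof -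
    define l' where "l' k = l k - l j" for k
    define K0 where "K0 = K - {j}"
    have K: "K = insert j K0" "j \<notin> K0" "finite K0" using j Suc.prems(1) by (auto simp: K0_def)
    have cK0: "m = card K0" using Suc.hyps(2) K by simp
    obtain p where p: "card T = Suc p" "m \<le> p"
      using Suc.hyps(2) Suc.prems(4) by (cases "card T") auto
    have T: "T \<noteq> {}" using p by auto
    have eq: "(\<Sum>k\<in>K. w k * exp (l' k * t)) = exp (- l j * t) * (\<Sum>k\<in>K. w k * exp (l k * t))" for t
      by (simp add: l'_def sum_distrib_left exp_diff exp_minus left_diff_distrib field_simps)
    obtain W where W: "finite W" "card W = p" "\<forall>t\<in>W. (\<Sum>k\<in>K. w k * l' k * exp (l' k * t)) = 0"
      using Rolle_finite[where f="\<lambda>t. \<Sum>k\<in>K. w k * exp (l' k * t)" and l="Min T" and r="Max T",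
          OF Suc.prems(3) p(1) _ _ exp_poly_deriv] Suc.prems(3,5) T eq
      by (auto simp: subset_iff)
    have "w k * l' k = 0"
    proof (rule Suc.hyps(1)[of K0 l' W "\<lambda>k. w k * l' k"])
      show "inj_on l' K0" using Suc.prems(2) by (auto simp: l'_def K0_def inj_on_def)
      show "(\<Sum>k\<in>K0. w k * l' k * exp (l' k * t)) = 0" if "t \<in> W" for t
        using W(3) that K by (simp add: l'_def)
    qed (use K cK0 W p kj in \<open>auto simp: K0_def\<close>)
    moreover have "l' k \<noteq> 0" using Suc.prems(2) kj j by (auto simp: l'_def inj_on_def)
    ultimately show ?thesis by simp
  qed
  show ?case
  proof (cases "\<exists>j\<in>K. j \<noteq> k")
    case True
    then obtain j where "j \<in> K" "j \<noteq> k" by blast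
    then show ?thesis using zero[of k j] Suc.prems(6) by blast
  next
    case False
    then have K: "K = {k}" using Suc.prems(6) by blast
    obtain t where "t \<in> T" using Suc.hyps(2) Suc.prems(4)
      by (metis card.empty equals0I not_less_eq_eq zero_le)
    then show ?thesis using Suc.prems(5)[of t] K by simp
  qed
qed

text \<open>Stating the injectivity hypothesis for all square subsystems is what lets the nodes and the
  functions be added one pair at a time.\<close>

lemma interpolation_exists:
  fixes m :: "'a \<Rightarrow> 'b \<Rightarrow> real"
  assumes "finite J" "finite U" "card J = card U"
    and inj: "\<And>J' U' b j. J' \<subseteq> J \<Longrightarrow> U' \<subseteq> U \<Longrightarrow> card J' = card U' \<Longrightarrow>
        (\<And>x. x \<in> U' \<Longrightarrow> (\<Sum>j\<in>J'. b j * m j x) = 0) \<Longrightarrow> j \<in> J' \<Longrightarrow> b j = 0"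
  shows "\<exists>b. \<forall>x\<in>U. (\<Sum>j\<in>J. b j * m j x) = y x"
  using assms
proof (induction J arbitrary: U y rule: finite_induct)
  case empty
  then show ?case by auto
next
  case (insert i J)
  then obtain x0 where x0: "x0 \<in> U" by fastforce
  define U0 where "U0 = U - {x0}"
  have U: "U = insert x0 U0" "x0 \<notin> U0" using x0 by (auto simp: U0_def)
  have c: "card J = card U0" "finite U0" using insert.prems insert.hyps x0 by (auto simp: U0_def)
  have IH: "\<exists>b. \<forall>x\<in>U0. (\<Sum>j\<in>J. b j * m j x) = z x" for z
  proof (rule insert.IH)
    show "b j = 0" if "J' \<subseteq> J" "U' \<subseteq> U0" "card J' = card U'"
        "\<And>x. x \<in> U' \<Longrightarrow> (\<Sum>j\<in>J'. b j * m j x) = 0" "j \<in> J'" for J' U' b j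
      by (rule insert.prems(3)[of J' U']) (use that U in auto)
  qed (use c in auto)
  \<comment> \<open>The combination \<open>p\<close> below has coefficient \<open>1\<close> at the new function \<open>i\<close> and vanishes at all
    old nodes, so by injectivity it cannot vanish at \<open>x0\<close>; a multiple of it corrects the value there.\<close>
  obtain d where d: "\<forall>x\<in>U0. (\<Sum>j\<in>J. d j * m j x) = - m i x" using IH[of "\<lambda>x. - m i x"] by blast
  obtain e where e: "\<forall>x\<in>U0. (\<Sum>j\<in>J. e j * m j x) = y x" using IH by blast
  define d' where "d' = d(i := 1)"
  define e' where "e' = e(i := 0)"
  have sd: "(\<Sum>j\<in>insert i J. d' j * m j x) = m i x + (\<Sum>j\<in>J. d j * m j x)" for x
    using insert.hyps by (auto simp: d'_def intro!: sum.cong)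
  have se: "(\<Sum>j\<in>insert i J. e' j * m j x) = (\<Sum>j\<in>J. e j * m j x)" for x
    using insert.hyps by (auto simp: e'_def intro!: sum.cong)
  define p where "p x = (\<Sum>j\<in>insert i J. d' j * m j x)" for x
  have p0: "p x = 0" if "x \<in> U0" for x unfolding p_def sd using that d by simp
  have "p x0 \<noteq> 0"
  proof
    assume "p x0 = 0"
    then have "p x = 0" if "x \<in> U" for x using that p0 U by auto
    then have "d' i = 0"
      using insert.prems(3)[of "insert i J" U d' i] insert.prems(2) by (auto simp: p_def)
    then show False by (simp add: d'_def)
  qed
  define s where "s = (y x0 - (\<Sum>j\<in>J. e j * m j x0)) / p x0"
  have lin: "(\<Sum>j\<in>insert i J. (e' j + s * d' j) * m j x) = (\<Sum>j\<in>J. e j * m j x) + s * p x" for x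
    unfolding p_def se[symmetric] by (simp add: sum.distrib sum_distrib_left algebra_simps del: sum.insert)
  show ?case
  proof (intro exI ballI)
    fix x assume "x \<in> U"
    then show "(\<Sum>j\<in>insert i J. (e' j + s * d' j) * m j x) = y x"
      unfolding lin using U p0 e \<open>p x0 \<noteq> 0\<close> by (auto simp: s_def)
  qed
qed

text \<open>The bound is the value approached when all nodes collide at \<open>0\<close>. For any \<open>i \<noteq> j\<close>,
  dividing the error function by its \<open>i\<close>-th exponential and differentiating
  gives an error function of the same kind without the \<open>i\<close>-th term and with one zero less, and,
  after normalising, the coefficient \<open>b j\<close> is multiplied by
  \<open>(n j - n i) / (M - n i)\<close>. The new zeros are interior to
  the old ones, hence negative, and so the bound is strict as soon as there are two nodes.\<close>

lemma exp_interpolation_bound: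
  fixes n b :: "'a \<Rightarrow> real"
  assumes "finite J" "inj_on n J" "\<And>j. j \<in> J \<Longrightarrow> n j < M"
    and "finite T" "card T = card J" "T \<subseteq> {..0}"
    and "\<And>t. t \<in> T \<Longrightarrow> exp (M * t) = (\<Sum>j\<in>J. b j * exp (n j * t))" and "j \<in> J"
  shows "\<bar>b j\<bar> \<le> (\<Prod>i\<in>J - {j}. \<bar>(M - n i) / (n j - n i)\<bar>) \<and>
    (2 \<le> card J \<or> T \<subseteq> {..<0} \<longrightarrow> \<bar>b j\<bar> < (\<Prod>i\<in>J - {j}. \<bar>(M - n i) / (n j - n i)\<bar>))"
  using assms
proof (induction "card J" arbitrary: J n b M T j)
  case 0
  then show ?case by simp
next
  case (Suc m)
  show ?case
  proof (cases "J = {j}")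
    case True
    then obtain t where t: "T = {t}" using Suc.prems(5) card_1_singletonE by force
    have "b j = exp ((M - n j) * t)"
      using Suc.prems(7)[of t] t True by (simp add: left_diff_distrib exp_diff field_simps)
    moreover have "t \<le> 0" "M - n j > 0" using Suc.prems(3,6,8) t by auto
    moreover have "(M - n j) * t < 0" if "t < 0" using that \<open>M - n j > 0\<close> by (rule mult_pos_neg[rotated])
    ultimately show ?thesis using t True by (auto simp: mult_le_0_iff)
  next
    case False
    then obtain i where i: "i \<in> J" "i \<noteq> j" using Suc.prems(8) by auto
    define K where "K = J - {i}"
    have J: "J = insert i K" "i \<notin> K" "finite K" using i Suc.prems(1) by (auto simp: K_def)
    have jK: "j \<in> K" using i Suc.prems(8) by (auto simp: K_def)
    have cK: "m = card K" using Suc.hyps(2) J by simp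
    \<comment> \<open>\<open>F\<close> is the error function divided by the \<open>i\<close>-th exponential.\<close>
    define n' where "n' k = n k - n i" for k
    define M' where "M' = M - n i"
    define b' where "b' k = b k * n' k / M'" for k
    have M'0: "M' > 0" using Suc.prems(3) i by (simp add: M'_def)
    define F where "F t = exp (M' * t) - (\<Sum>k\<in>J. b k * exp (n' k * t))" for t
    define F' where "F' t = M' * exp (M' * t) - (\<Sum>k\<in>J. b k * n' k * exp (n' k * t))" for t
    have "F t = 0" if "t \<in> T" for t
    proof -
      have "(\<Sum>k\<in>J. b k * exp (n' k * t)) = exp (- n i * t) * (\<Sum>k\<in>J. b k * exp (n k * t))"
        by (simp add: n'_def sum_distrib_left exp_diff exp_minus left_diff_distrib field_simps)
      then show ?thesis using Suc.prems(7)[OF that]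
        by (simp add: F_def M'_def left_diff_distrib exp_diff exp_minus field_simps)
    qed
    moreover have "(F has_real_derivative F' t) (at t)" for t
      unfolding F_def F'_def by (rule DERIV_diff) (auto intro!: derivative_eq_intros exp_poly_deriv)
    moreover have "T \<noteq> {}" using Suc.hyps(2) Suc.prems(5) by auto
    then have "T \<subseteq> {Min T..0}" using Suc.prems(4,6) by auto
    ultimately obtain W where W: "finite W" "card W = m" "W \<subseteq> {Min T<..<0}" "\<forall>t\<in>W. F' t = 0"
      using Rolle_finite[of T m "Min T" 0 F F'] Suc.prems(4,5) Suc.hyps(2) by auto
    have IH: "\<bar>b' j\<bar> < (\<Prod>k\<in>K - {j}. \<bar>(M' - n' k) / (n' j - n' k)\<bar>)"
    proof -
      have "exp (M' * t) = (\<Sum>k\<in>K. b' k * exp (n' k * t))" if "t \<in> W" for t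
      proof -
        have "M' * exp (M' * t) = (\<Sum>k\<in>K. b k * n' k * exp (n' k * t))"
          using W(4) that J by (simp add: F'_def n'_def)
        also have "\<dots> = M' * (\<Sum>k\<in>K. b' k * exp (n' k * t))"
          using M'0 by (simp add: b'_def sum_distrib_left)
        finally show ?thesis using M'0 by simp
      qed
      moreover have "inj_on n' K" using Suc.prems(2) by (auto simp: n'_def K_def inj_on_def)
      moreover have "W \<subseteq> {..<0}" "W \<subseteq> {..0}" using W(3) by force+
      ultimately show ?thesis
        using Suc.hyps(1)[OF cK J(3) _ _ W(1), of n' M' b' j] cK W(2) jK Suc.prems(3) J(1)
        unfolding n'_def M'_def by (simp add: W(2))
    qed
    have ne: "n j \<noteq> n i" using Suc.prems(2,8) i by (auto simp: inj_on_def)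
    have "J - {j} = insert i (K - {j})" "i \<notin> K - {j}" using J i by auto
    then have "(\<Prod>k\<in>J - {j}. \<bar>(M - n k) / (n j - n k)\<bar>)
        = \<bar>M' / n' j\<bar> * (\<Prod>k\<in>K - {j}. \<bar>(M' - n' k) / (n' j - n' k)\<bar>)"
      using J by (simp add: M'_def n'_def)
    moreover have "\<bar>b j\<bar> = \<bar>M' / n' j\<bar> * \<bar>b' j\<bar>"
      using M'0 ne by (simp add: b'_def n'_def abs_mult abs_divide)
    moreover have "\<bar>M' / n' j\<bar> > 0" using M'0 ne by (simp add: n'_def)
    ultimately have "\<bar>b j\<bar> < (\<Prod>k\<in>J - {j}. \<bar>(M - n k) / (n j - n k)\<bar>)"
      using mult_strict_left_mono[OF IH] by metis
    then show ?thesis by simp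
  qed
qed

section \<open>Positive semidefinite forms on a finite index set\<close>

definition qform :: "'a set \<Rightarrow> ('a \<Rightarrow> 'a \<Rightarrow> real) \<Rightarrow> ('a \<Rightarrow> real) \<Rightarrow> real" where
  "qform S a v = (\<Sum>i\<in>S. \<Sum>j\<in>S. v i * v j * a i j)"

definition psd :: "'a set \<Rightarrow> ('a \<Rightarrow> 'a \<Rightarrow> real) \<Rightarrow> bool" where
  "psd S a \<longleftrightarrow> (\<forall>i\<in>S. \<forall>j\<in>S. a i j = a j i) \<and> (\<forall>v. 0 \<le> qform S a v)"

lemma psd_sym: "psd S a \<Longrightarrow> i \<in> S \<Longrightarrow> j \<in> S \<Longrightarrow> a i j = a j i"
  by (simp add: psd_def)

lemma psd_nonneg: "psd S a \<Longrightarrow> 0 \<le> qform S a v"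
  by (simp add: psd_def)

lemma qform_cong:
  "(\<And>i j. i \<in> S \<Longrightarrow> j \<in> S \<Longrightarrow> a i j = b i j) \<Longrightarrow> (\<And>i. i \<in> S \<Longrightarrow> v i = w i)
    \<Longrightarrow> qform S a v = qform S b w"
  unfolding qform_def by (intro sum.cong) auto

lemma qform_add: "qform S (\<lambda>i j. a i j + b i j) v = qform S a v + qform S b v"
  by (simp add: qform_def sum.distrib distrib_left)

lemma qform_scale: "qform S (\<lambda>i j. r * a i j) v = r * qform S a v"
  by (simp add: qform_def sum_distrib_left mult_ac)

lemma qform_diff: "qform S (\<lambda>i j. a i j - b i j) v = qform S a v - qform S b v"
  by (simp add: qform_def sum_subtractf right_diff_distrib)

lemma qform_sum: "qform S (\<lambda>i j. \<Sum>k\<in>K. a k i j) v = (\<Sum>k\<in>K. qform S (a k) v)"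
  by (induction K rule: infinite_finite_induct) (simp_all add: qform_add, simp_all add: qform_def)

lemma qform_rank_one: "qform S (\<lambda>i j. u i * u j) v = (\<Sum>i\<in>S. v i * u i)\<^sup>2"
  by (simp add: qform_def power2_eq_square sum_product mult_ac)

lemma qform_zero_extend:
  assumes "finite S" "T \<subseteq> S" "\<And>i. i \<in> S - T \<Longrightarrow> v i = 0"
  shows "qform S a v = qform T a v"
proof -
  have "(\<Sum>j\<in>S. v i * v j * a i j) = (\<Sum>j\<in>T. v i * v j * a i j)" for i
    by (rule sum.mono_neutral_right) (use assms in auto)
  then have "qform S a v = (\<Sum>i\<in>S. \<Sum>j\<in>T. v i * v j * a i j)"
    by (simp add: qform_def)
  also have "\<dots> = qform T a v"
    unfolding qform_def by (rule sum.mono_neutral_right) (use assms in auto)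
  finally show ?thesis .
qed

lemma qform_zero_row:
  assumes "finite S" "i \<in> S" "\<And>j. j \<in> S \<Longrightarrow> a i j = 0 \<and> a j i = 0"
  shows "qform S a v = qform (S - {i}) a v"
proof -
  have "qform S a v = qform S a (v(i := 0))"
    unfolding qform_def using assms(3) by (intro sum.cong) auto
  also have "\<dots> = qform (S - {i}) a (v(i := 0))"
    by (rule qform_zero_extend) (use assms in auto)
  also have "\<dots> = qform (S - {i}) a v" by (rule qform_cong) auto
  finally show ?thesis .
qed

lemma psd_subset:
  assumes "finite S" "T \<subseteq> S" "psd S a"
  shows "psd T a"
proof -
  have "0 \<le> qform T a v" for v
  proof -
    have "qform T a v = qform T a (\<lambda>i. if i \<in> T then v i else 0)" by (rule qform_cong) auto
    also have "\<dots> = qform S a (\<lambda>i. if i \<in> T then v i else 0)"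
      by (rule qform_zero_extend[symmetric]) (use assms in auto)
    finally show ?thesis using assms(3) by (simp add: psd_nonneg)
  qed
  then show ?thesis using assms unfolding psd_def by (meson subsetD)
qed

lemma psd_rank_one: "psd S (\<lambda>i j. u i * u j)"
  unfolding psd_def by (simp add: qform_rank_one mult.commute)

lemma psd_add: "psd S a \<Longrightarrow> psd S b \<Longrightarrow> psd S (\<lambda>i j. a i j + b i j)"
  by (simp add: psd_def qform_add)

lemma psd_scale: "psd S a \<Longrightarrow> 0 \<le> r \<Longrightarrow> psd S (\<lambda>i j. r * a i j)"
  by (simp add: psd_def qform_scale)

lemma psd_cong:
  "(\<And>i j. i \<in> S \<Longrightarrow> j \<in> S \<Longrightarrow> a i j = b i j) \<Longrightarrow> psd S a = psd S b"
  unfolding psd_def by (auto cong: qform_cong)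

lemma quadratic_nonneg_discriminant:
  fixes x y z :: real
  assumes "0 \<le> z" "\<And>t. 0 \<le> x + 2 * t * y + t\<^sup>2 * z"
  shows "y\<^sup>2 \<le> x * z"
proof (cases "z = 0")
  case True
  have "y = 0"
  proof (rule ccontr)
    assume "y \<noteq> 0"
    then show False using assms(2)[of "- (x + 1) / (2 * y)"] True by (simp add: field_simps)
  qed
  then show ?thesis using True by simp
next
  case False
  have "0 \<le> z * (x + 2 * (- y / z) * y + (- y / z)\<^sup>2 * z)"
    by (rule mult_nonneg_nonneg[OF assms(1) assms(2)])
  also have "\<dots> = x * z - y\<^sup>2" using False by (simp add: field_simps power2_eq_square)
  finally show ?thesis by simp
qed

text \<open>The Cauchy-Schwarz inequality for the form, applied to \<open>v\<close> and the \<open>i\<close>-th unit vector.\<close>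

lemma psd_row_bound:
  assumes "finite S" "psd S a" "i \<in> S"
  shows "(\<Sum>j\<in>S. a i j * v j)\<^sup>2 \<le> qform S a v * a i i"
proof (rule quadratic_nonneg_discriminant)
  define e where "e j = (if j = i then 1 else 0 :: real)" for j
  have row: "(\<Sum>k\<in>S. e k * g k) = g i" for g
    using assms by (simp add: e_def if_distrib[of "\<lambda>x. x * _"] cong: if_cong)
  have eq: "qform S a (\<lambda>k. v k + t * e k)
      = qform S a v + 2 * t * (\<Sum>j\<in>S. a i j * v j) + t\<^sup>2 * a i i" for t
  proof -
    have "qform S a (\<lambda>k. v k + t * e k) = qform S a v
        + t * (\<Sum>k\<in>S. e k * (\<Sum>j\<in>S. v j * a k j)) + t * (\<Sum>j\<in>S. v j * (\<Sum>k\<in>S. e k * a j k))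
        + t\<^sup>2 * (\<Sum>k\<in>S. e k * (\<Sum>j\<in>S. e j * a k j))"
      by (simp add: qform_def sum.distrib sum_distrib_left algebra_simps power2_eq_square)
    also have "(\<Sum>j\<in>S. v j * (\<Sum>k\<in>S. e k * a j k)) = (\<Sum>j\<in>S. a i j * v j)"
      unfolding row using assms by (intro sum.cong) (auto simp: psd_sym mult.commute)
    finally show ?thesis unfolding row by (simp add: mult.commute)
  qed
  show "0 \<le> qform S a v + 2 * t * (\<Sum>j\<in>S. a i j * v j) + t\<^sup>2 * a i i" for t
    unfolding eq[symmetric] by (rule psd_nonneg[OF assms(2)])
  have "qform S a e = (\<Sum>k\<in>S. e k * (\<Sum>j\<in>S. e j * a k j))"
    by (simp add: qform_def sum_distrib_left mult.assoc)
  also have "\<dots> = a i i" unfolding row ..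
  finally have "qform S a e = a i i" .
  then show "0 \<le> a i i" using psd_nonneg[OF assms(2), of e] by simp
qed

lemma psd_diag_nonneg:
  assumes "finite S" "psd S a" "i \<in> S"
  shows "0 \<le> a i i"
  using psd_nonneg[OF psd_subset[OF assms(1) _ assms(2), of "{i}"], of "\<lambda>_. 1"] assms(3)
  by (simp add: qform_def)

lemma psd_minor:
  assumes "finite S" "psd S a" "i \<in> S" "j \<in> S"
  shows "(a i j)\<^sup>2 \<le> a i i * a j j"
proof -
  have "(\<Sum>k\<in>S. a i k * (if k = j then 1 else 0)) = a i j"
    using assms by (simp add: if_distrib[of "\<lambda>x. _ * x"] cong: if_cong)
  moreover have "qform S a (\<lambda>k. if k = j then 1 else 0) = a j j"
  proof -
    have "qform S a (\<lambda>k. if k = j then 1 else 0) = qform {j} a (\<lambda>k. if k = j then 1 else 0)"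
      by (rule qform_zero_extend) (use assms in auto)
    then show ?thesis by (simp add: qform_def)
  qed
  ultimately show ?thesis
    using psd_row_bound[OF assms(1-3), of "\<lambda>k. if k = j then 1 else 0"] by (simp add: mult.commute)
qed

lemma psd_zero_diag:
  assumes "finite S" "psd S a" "i \<in> S" "j \<in> S" "a i i = 0"
  shows "a i j = 0"
  using psd_minor[OF assms(1-4)] assms(5) by simp

lemma psd_kernel:
  assumes "finite S" "psd S a" "i \<in> S" "qform S a v = 0"
  shows "(\<Sum>j\<in>S. a i j * v j) = 0"
  using psd_row_bound[OF assms(1-3), of v] assms(4) by simp

lemma psd_schur_complement:
  assumes "finite S" "psd S a" "i \<in> S" "a i i > 0"
  shows "psd S (\<lambda>j k. a j k - a i j * a i k / a i i)"
proof -
  have "0 \<le> qform S (\<lambda>j k. a j k - a i j * a i k / a i i) v" for v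
  proof -
    have "qform S (\<lambda>j k. a j k - a i j * a i k / a i i) v
        = qform S a v - inverse (a i i) * qform S (\<lambda>j k. a i j * a i k) v"
      unfolding qform_scale[symmetric] qform_diff[symmetric] by (simp add: field_simps)
    also have "\<dots> = qform S a v - (\<Sum>j\<in>S. a i j * v j)\<^sup>2 / a i i"
      by (simp add: qform_rank_one mult.commute divide_inverse)
    finally show ?thesis
      using psd_row_bound[OF assms(1-3), of v] assms(4) by (simp add: pos_divide_le_eq)
  qed
  then show ?thesis using assms unfolding psd_def by (auto simp: mult.commute)
qed

text \<open>Splitting off the rank one part through a positive diagonal entry of \<open>a\<close> leaves a Schur
  complement that lives on fewer indices. The entrywise product of \<open>b\<close> with the rank one part
  is \<open>b\<close> with rows and columns rescaled.\<close>

lemma psd_schur_product: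
  assumes "finite S" "psd S a" "psd S b"
  shows "psd S (\<lambda>i j. a i j * b i j)"
  using assms
proof (induction "card S" arbitrary: S a)
  case 0
  then show ?case by (simp add: psd_def qform_def)
next
  case (Suc m)
  have "0 \<le> qform S (\<lambda>i j. a i j * b i j) v" for v
  proof (cases "\<exists>i\<in>S. a i i > 0")
    case False
    then have "a i j = 0" if "i \<in> S" "j \<in> S" for i j
      using psd_zero_diag[OF Suc.prems(1,2) that] psd_diag_nonneg[OF Suc.prems(1,2) that(1)] that
      by force
    then show ?thesis by (simp add: qform_def)
  next
    case True
    then obtain i where i: "i \<in> S" "a i i > 0" by blast
    define a' where "a' j k = a j k - a i j * a i k / a i i" for j k
    have a': "psd S a'"
      unfolding a'_def by (rule psd_schur_complement[OF Suc.prems(1,2) i])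
    have row: "a' i j = 0 \<and> a' j i = 0" if "j \<in> S" for j
      using i that psd_sym[OF Suc.prems(2), of i j] by (simp add: a'_def)
    have "psd (S - {i}) (\<lambda>j k. a' j k * b j k)"
      using Suc.prems Suc.hyps(2) i(1) psd_subset[OF Suc.prems(1) _ a', of "S - {i}"]
        psd_subset[OF Suc.prems(1) _ Suc.prems(3), of "S - {i}"]
      by (intro Suc.hyps(1)) auto
    then have "0 \<le> qform S (\<lambda>j k. a' j k * b j k) v"
      using qform_zero_row[of S i "\<lambda>j k. a' j k * b j k" v] Suc.prems(1) i(1) row
      by (simp add: psd_nonneg)
    moreover have "qform S (\<lambda>j k. a j k * b j k) v = qform S (\<lambda>j k. a' j k * b j k) v
        + qform S b (\<lambda>j. v j * a i j) / a i i"
      using i(2) unfolding qform_def sum_divide_distrib sum.distrib[symmetric]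
      by (intro sum.cong refl) (simp add: a'_def field_simps)
    ultimately show ?thesis using psd_nonneg[OF Suc.prems(3)] i(2) by simp
  qed
  then show ?case using Suc.prems by (simp add: psd_def)
qed

section \<open>Real powers\<close>

text \<open>The real counterpart of \<^const>\<open>rpow\<close>. The value at base \<open>0\<close> is \<open>0\<close> for every \<open>a \<noteq> 0\<close>, including
  negative \<open>a\<close>.\<close>

definition rp :: "real \<Rightarrow> real \<Rightarrow> real" where
  "rp x a = (if a = 0 then 1 else x powr a)"

lemma rp_zero_base [simp]: "a \<noteq> 0 \<Longrightarrow> rp 0 a = 0"
  by (simp add: rp_def)

lemma rp_zero_exponent [simp]: "rp x 0 = 1"
  by (simp add: rp_def)

lemma rp_exp: "0 < x \<Longrightarrow> rp x a = exp (a * ln x)"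
  by (simp add: rp_def powr_def)

lemma rp_mult: "0 \<le> x \<Longrightarrow> 0 \<le> y \<Longrightarrow> rp (x * y) a = rp x a * rp y a"
  by (simp add: rp_def powr_mult)

lemma rp_deriv:
  assumes "0 < x"
  shows "((\<lambda>x. rp x a) has_real_derivative a * rp x (a - 1)) (at x)"
proof (cases "a = 0")
  case False
  then have "((\<lambda>x. rp x a) has_real_derivative a * x powr (a - 1)) (at x)"
    using has_real_derivative_powr[OF assms, of a] by (simp add: rp_def)
  moreover have "x powr (a - 1) = rp x (a - 1)" using assms by (simp add: rp_def)
  ultimately show ?thesis by simp
qed simp

lemma rp_continuous:
  assumes "0 \<le> a"
  shows "continuous_on {0..r} (\<lambda>x. rp x a)"
proof (cases "a = 0")
  case False
  then show ?thesis using assms unfolding rp_def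
    by (auto intro!: continuous_on_powr')
qed simp

section \<open>Comparing an entrywise image with that of a rank one matrix\<close>

lemma rank_one_part:
  assumes "finite S" "psd S a" "i \<in> S" "a i i > 0" "\<And>j k. j \<in> S \<Longrightarrow> k \<in> S \<Longrightarrow> a j k \<in> {0..r}"
    and "j \<in> S" "k \<in> S"
  shows "a i j * a i k / a i i \<in> {0..r}"
proof -
  have "(a i j)\<^sup>2 \<le> a i i * r" if "j \<in> S" for j
    by (rule order_trans[OF psd_minor[OF assms(1-3) that]], rule mult_left_mono)
      (use assms(4) assms(5)[OF that that] in auto)
  from this[OF assms(6)] this[OF assms(7)] have "2 * (a i j * a i k) \<le> 2 * (a i i * r)"
    using sum_squares_bound[of "a i j" "a i k"] by linarith
  moreover have "0 \<le> a i j" "0 \<le> a i k" using assms(5)[OF assms(3)] assms(6,7) by auto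
  ultimately show ?thesis using assms(4) by (simp add: divide_le_eq mult.commute)
qed

text \<open>The matrix \<open>a i j * a i k / a i i\<close> is the rank one matrix with the same \<open>i\<close>-th row as \<open>a\<close>, and \<open>d\<close>
  below, the difference of the two, is a Schur complement. Along the segment \<open>B t\<close> from the rank one
  matrix to \<open>a\<close> the form of \<open>F\<close> has as derivative the form of the entrywise product of \<open>d\<close> with
  \<open>F' (B t)\<close>. Since row \<open>i\<close> of \<open>d\<close> vanishes, only \<open>S - {i}\<close> matters, and the Schur product theorem
  makes the derivative nonnegative. The derivative of \<open>F\<close> at
  positive points suffices, since an entry of \<open>B t\<close> with \<open>0 < t < 1\<close> is zero only if it is constant
  in \<open>t\<close>.\<close>

lemma entrywise_ge_rank_one:
  fixes F F' :: "real \<Rightarrow> real"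
  assumes S: "finite S" and a: "psd S a" and i: "i \<in> S" "a i i > 0"
    and entries: "\<And>j k. j \<in> S \<Longrightarrow> k \<in> S \<Longrightarrow> a j k \<in> {0..r}"
    and cont: "continuous_on {0..r} F"
    and deriv: "\<And>x. 0 < x \<Longrightarrow> (F has_real_derivative F' x) (at x)"
    and pres: "\<And>b. psd (S - {i}) b \<Longrightarrow> (\<And>j k. j \<in> S - {i} \<Longrightarrow> k \<in> S - {i} \<Longrightarrow> b j k \<in> {0..r})
        \<Longrightarrow> psd (S - {i}) (\<lambda>j k. F' (b j k))"
  shows "qform S (\<lambda>j k. F (a i j * a i k / a i i)) v \<le> qform S (\<lambda>j k. F (a j k)) v"
proof -
  define z where "z j k = a i j * a i k / a i i" for j k
  define d where "d j k = a j k - z j k" for j k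
  define B where "B t j k = z j k + t * d j k" for t j k
  have z: "z j k \<in> {0..r}" if "j \<in> S" "k \<in> S" for j k
    unfolding z_def by (rule rank_one_part) (use assms that in auto)
  have B_conv: "B t j k = (1 - t) * z j k + t * a j k" for t j k
    by (simp add: B_def d_def algebra_simps)
  have B: "B t j k \<in> {0..r}" if "j \<in> S" "k \<in> S" "t \<in> {0..1}" for t j k
  proof -
    have "(1 - t) * z j k + t * a j k \<le> (1 - t) * r + t * r"
      using that z[OF that(1,2)] entries[OF that(1,2)] by (intro add_mono mult_left_mono) auto
    moreover have "0 \<le> (1 - t) * z j k + t * a j k"
      using that z[OF that(1,2)] entries[OF that(1,2)] by (intro add_nonneg_nonneg mult_nonneg_nonneg) auto
    ultimately show ?thesis unfolding B_conv by (simp add: algebra_simps)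
  qed
  have "psd S z"
  proof -
    have "z = (\<lambda>j k. (a i j / sqrt (a i i)) * (a i k / sqrt (a i i)))"
      using i(2) by (intro ext) (simp add: z_def)
    then show ?thesis using psd_rank_one[of S "\<lambda>j. a i j / sqrt (a i i)"] by simp
  qed
  then have psd_B: "psd S (B t)" if "t \<in> {0..1}" for t
    unfolding B_conv[abs_def] using a that by (intro psd_add psd_scale) auto
  have psd_d: "psd S d"
    unfolding d_def z_def using psd_schur_complement[OF S a i] .
  have row: "d i j = 0 \<and> d j i = 0" if "j \<in> S" for j
    using i that psd_sym[OF a, of i j] by (simp add: d_def z_def)
  define G where "G t = qform S (\<lambda>j k. F (B t j k)) v" for t
  have "G 0 \<le> G 1"
  proof (rule DERIV_nonneg_imp_increasing_open[where f = G and a = 0 and b = 1])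
    fix t :: real assume t: "0 < t" "t < 1"
    have "((\<lambda>t. F (B t j k)) has_real_derivative d j k * F' (B t j k)) (at t)"
      if "j \<in> S" "k \<in> S" for j k
    proof (cases "d j k = 0")
      case True
      then show ?thesis by (simp add: B_def)
    next
      case False
      then have "0 < z j k \<or> 0 < a j k" using z[OF that] entries[OF that] by (auto simp: d_def)
      then have "0 < B t j k" unfolding B_conv using t z[OF that] entries[OF that]
        by (auto intro: add_pos_nonneg add_nonneg_pos)
      then have "((\<lambda>t. F (B t j k)) has_real_derivative F' (B t j k) * d j k) (at t)"
        by (intro DERIV_chain2[of F, OF deriv]) (auto simp: B_def intro!: derivative_eq_intros)
      then show ?thesis by (simp add: mult.commute)
    qed
    then have "(G has_real_derivative qform S (\<lambda>j k. d j k * F' (B t j k)) v) (at t)"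
      unfolding G_def qform_def by (intro DERIV_sum DERIV_cmult) auto
    moreover have "0 \<le> qform S (\<lambda>j k. d j k * F' (B t j k)) v"
    proof -
      have "psd (S - {i}) (\<lambda>j k. F' (B t j k))"
        using B t psd_subset[OF S _ psd_B, of "S - {i}" t] by (intro pres) auto
      then have "psd (S - {i}) (\<lambda>j k. d j k * F' (B t j k))"
        using psd_subset[OF S _ psd_d, of "S - {i}"] S by (intro psd_schur_product) auto
      then show ?thesis
        using qform_zero_row[OF S i(1), of "\<lambda>j k. d j k * F' (B t j k)"] row
        by (simp add: psd_nonneg)
    qed
    ultimately show "\<exists>y. (G has_real_derivative y) (at t) \<and> 0 \<le> y" by blast
  next
    have "continuous_on {0..1} (\<lambda>t. F (B t j k))" if "j \<in> S" "k \<in> S" for j k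
      by (rule continuous_on_compose2[OF cont])
        (use B[OF that] in \<open>auto simp: B_def intro!: continuous_intros\<close>)
    then show "continuous_on {0..1} G"
      unfolding G_def qform_def by (intro continuous_on_sum continuous_on_mult_left) auto
  qed simp
  then show ?thesis by (simp add: G_def B_def d_def z_def)
qed

lemma no_positive_diag_imp_zero:
  assumes "finite S" "psd S a" "\<not> (\<exists>i\<in>S. a i i > 0)" "i \<in> S" "j \<in> S"
  shows "a i j = 0"
  using psd_zero_diag[OF assms(1,2,4,5)] psd_diag_nonneg[OF assms(1,2,4)] assms(3,4) by force

lemma rp_rank_one:
  assumes "\<And>j. j \<in> S \<Longrightarrow> 0 \<le> u j"
  shows "qform S (\<lambda>j k. rp (u j * u k) p) v = (\<Sum>j\<in>S. v j * rp (u j) p)\<^sup>2"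
proof -
  have "qform S (\<lambda>j k. rp (u j * u k) p) v = qform S (\<lambda>j k. rp (u j) p * rp (u k) p) v"
    by (rule qform_cong) (use assms in \<open>auto simp: rp_mult\<close>)
  then show ?thesis by (simp only: qform_rank_one)
qed

lemma psd_rp_rank_one:
  assumes "\<And>j. j \<in> S \<Longrightarrow> 0 \<le> u j"
  shows "psd S (\<lambda>j k. rp (u j * u k) p)"
  unfolding psd_def by (simp add: rp_rank_one[OF assms] mult.commute)

text \<open>The derivative of the \<open>p\<close>-th power is a nonnegative multiple of the power \<open>p - 1\<close>, which is
  needed on one index less, so the condition on \<open>p\<close> is inherited; the comparison with a rank one
  matrix then closes the induction.\<close>

lemma psd_power:
  assumes "finite S" "psd S a" "\<And>j k. j \<in> S \<Longrightarrow> k \<in> S \<Longrightarrow> a j k \<in> {0..r}"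
    and "p \<in> \<nat> \<union> {real (card S) - 1..}"
  shows "psd S (\<lambda>j k. rp (a j k) p)"
  using assms
proof (induction "card S" arbitrary: S a p)
  case 0
  then show ?case by (simp add: psd_def qform_def)
next
  case (Suc m)
  have p0: "0 \<le> p" using Suc.prems(4) Suc.hyps(2) by (auto simp: Nats_def)
  consider "p = 0" | "0 < p" "\<not> (\<exists>i\<in>S. a i i > 0)" | i where "0 < p" "i \<in> S" "a i i > 0"
    using p0 by force
  then show ?case
  proof cases
    case 1
    then show ?thesis using psd_rank_one[of S "\<lambda>_. 1"] by simp
  next
    case 2
    have "psd S (\<lambda>j k. rp (a j k) p) = psd S (\<lambda>j k. 0 * 0)"
      by (rule psd_cong) (use no_positive_diag_imp_zero[OF Suc.prems(1,2) 2(2)] 2(1) in auto)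
    then show ?thesis using psd_rank_one[of S "\<lambda>_. 0"] by simp
  next
    case (3 i)
    define u where "u j = a i j / sqrt (a i i)" for j
    have u: "a i j * a i k / a i i = u j * u k" for j k using 3(3) by (simp add: u_def)
    have u0: "0 \<le> u j" if "j \<in> S" for j using Suc.prems(3)[OF 3(2) that] 3(3) by (simp add: u_def)
    have "0 \<le> qform S (\<lambda>j k. rp (a j k) p) v" for v
    proof -
      have "qform S (\<lambda>j k. rp (a i j * a i k / a i i) p) v \<le> qform S (\<lambda>j k. rp (a j k) p) v"
      proof (rule entrywise_ge_rank_one[where F="\<lambda>x. rp x p" and F'="\<lambda>x. p * rp x (p - 1)"])
        fix b assume b: "psd (S - {i}) b" "\<And>j k. j \<in> S - {i} \<Longrightarrow> k \<in> S - {i} \<Longrightarrow> b j k \<in> {0..r}"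
        have "p - 1 \<in> \<nat> \<union> {real (card (S - {i})) - 1..}"
        proof (cases "p \<in> \<nat>")
          case True
          then obtain q where "p = real q" by (auto simp: Nats_def)
          then have "p - 1 = real (q - 1)" using 3(1) by auto
          then show ?thesis by auto
        next
          case False
          then have "real (card S) - 1 \<le> p" using Suc.prems(4) by auto
          moreover have "real (card (S - {i})) = real (card S) - 1"
            using 3(2) Suc.prems(1) Suc.hyps(2) by (simp add: card_Diff_singleton)
          ultimately show ?thesis by simp
        qed
        then have "psd (S - {i}) (\<lambda>j k. rp (b j k) (p - 1))"
          using b Suc.prems(1) Suc.hyps(2) 3(2) by (intro Suc.hyps(1)) auto
        then show "psd (S - {i}) (\<lambda>j k. p * rp (b j k) (p - 1))"
          using 3(1) by (intro psd_scale) auto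
      next
        show "a j k \<in> {0..r}" if "j \<in> S" "k \<in> S" for j k by (rule Suc.prems(3)[OF that])
      qed (fact Suc.prems(1) Suc.prems(2) 3(2) 3(3) rp_continuous[OF p0] rp_deriv)+
      moreover have "qform S (\<lambda>j k. rp (a i j * a i k / a i i) p) v = (\<Sum>j\<in>S. v j * rp (u j) p)\<^sup>2"
        unfolding u by (rule rp_rank_one) (rule u0)
      ultimately show ?thesis by (simp add: order_trans[OF zero_le_power2])
    qed
    moreover have "rp (a j k) p = rp (a k j) p" if "j \<in> S" "k \<in> S" for j k
      using psd_sym[OF Suc.prems(2) that] by simp
    ultimately show ?thesis unfolding psd_def by blast
  qed
qed

section \<open>Interpolating a power by lower powers\<close>

text \<open>The limit, as all nodes tend to \<open>1\<close>, of the absolute value of the \<open>j\<close>-th coefficient when \<open>x\<^sup>M\<close>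
  is interpolated by the powers \<open>x\<^bsup>n j\<^esup>\<close>. It equals the absolute value of the quotient
  \<open>V(n\<^sub>j) / V(n)\<close> of Vandermonde products.\<close>

definition ratio_prod :: "'a set \<Rightarrow> ('a \<Rightarrow> real) \<Rightarrow> real \<Rightarrow> 'a \<Rightarrow> real" where
  "ratio_prod J n M j = (\<Prod>i\<in>J - {j}. \<bar>(M - n i) / (n j - n i)\<bar>)"

lemma ratio_prod_pos:
  assumes "inj_on n J" "\<And>j. j \<in> J \<Longrightarrow> n j < M" "j \<in> J"
  shows "0 < ratio_prod J n M j"
  unfolding ratio_prod_def
proof (rule prod_pos)
  fix i assume i: "i \<in> J - {j}"
  then have "n i < M" "n j \<noteq> n i" using assms by (auto simp: inj_on_def)
  then show "0 < \<bar>(M - n i) / (n j - n i)\<bar>" by simp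
qed

lemma ratio_prod_remove:
  assumes "finite J" "i \<in> J" "i \<noteq> j"
  shows "ratio_prod J n M j = \<bar>(M - n i) / (n j - n i)\<bar> * ratio_prod (J - {i}) n M j"
proof -
  have "J - {j} = insert i (J - {i} - {j})" using assms by auto
  then show ?thesis unfolding ratio_prod_def using assms(1) by simp
qed

text \<open>The substitution \<open>t = ln (x / R)\<close> turns nodes in \<open>(0, R]\<close> into nodes in \<open>(-\<infinity>, 0]\<close> and powers into
  exponentials.\<close>

lemma power_interpolation_pos:
  fixes n :: "'a \<Rightarrow> real"
  assumes J: "finite J" "inj_on n J" "\<And>j. j \<in> J \<Longrightarrow> n j < M"
    and U: "finite U" "card U = card J" "U \<subseteq> {0<..R}"
  shows "\<exists>b. (\<forall>x\<in>U. rp x M = (\<Sum>j\<in>J. b j * rp x (n j))) \<and>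
    (\<forall>j\<in>J. \<bar>b j\<bar> \<le> ratio_prod J n M j * R powr (M - n j) \<and>
      (2 \<le> card J \<longrightarrow> \<bar>b j\<bar> < ratio_prod J n M j * R powr (M - n j)))"
proof (cases "U = {}")
  case True
  then have "J = {}" using U J by auto
  then show ?thesis using True by auto
next
  case False
  then have R: "0 < R" using U(3) by force
  define T where "T = (\<lambda>x. ln (x / R)) ` U"
  have "inj_on (\<lambda>x. ln (x / R)) U"
  proof (rule inj_onI)
    fix x y assume "x \<in> U" "y \<in> U" "ln (x / R) = ln (y / R)"
    moreover from this have "0 < x" "0 < y" using U(3) by auto
    ultimately show "x = y" using R by (simp add: ln_div)
  qed
  then have T: "finite T" "card T = card J" using U by (auto simp: T_def card_image)
  have T0: "T \<subseteq> {..0}" using U(3) R by (auto simp: T_def)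
  have "\<exists>b. \<forall>t\<in>T. (\<Sum>j\<in>J. b j * exp (n j * t)) = exp (M * t)"
  proof (rule interpolation_exists)
    fix J' T' and b :: "'a \<Rightarrow> real" and j
    assume *: "J' \<subseteq> J" "T' \<subseteq> T" "card J' = card T'" "j \<in> J'"
      "\<And>t. t \<in> T' \<Longrightarrow> (\<Sum>j\<in>J'. b j * exp (n j * t)) = 0"
    show "b j = 0"
      by (rule exp_poly_zero[of J' n T'])
        (use * J T in \<open>auto intro: finite_subset inj_on_subset\<close>)
  qed (use J T in auto)
  then obtain b' where b': "\<And>t. t \<in> T \<Longrightarrow> exp (M * t) = (\<Sum>j\<in>J. b' j * exp (n j * t))" by metis
  define b where "b j = b' j * R powr (M - n j)" for j
  have pe: "rp x e = R powr e * exp (e * ln (x / R))" if "x \<in> U" for x e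
  proof -
    have "0 < x" using that U(3) by auto
    then show ?thesis using R by (simp add: rp_exp powr_def ln_div exp_add[symmetric] algebra_simps)
  qed
  have "rp x M = (\<Sum>j\<in>J. b j * rp x (n j))" if x: "x \<in> U" for x
  proof -
    have "rp x M = (\<Sum>j\<in>J. R powr M * (b' j * exp (n j * ln (x / R))))"
      using b'[of "ln (x / R)"] x by (simp add: pe T_def sum_distrib_left)
    also have "\<dots> = (\<Sum>j\<in>J. b j * rp x (n j))"
      using R by (intro sum.cong refl) (simp add: pe[OF x] b_def powr_diff)
    finally show ?thesis .
  qed
  moreover have "\<bar>b j\<bar> \<le> ratio_prod J n M j * R powr (M - n j) \<and>
      (2 \<le> card J \<longrightarrow> \<bar>b j\<bar> < ratio_prod J n M j * R powr (M - n j))" if "j \<in> J" for j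
    using exp_interpolation_bound[OF J T T0 b' that] R
    by (simp add: b_def abs_mult ratio_prod_def)
  ultimately show ?thesis by blast
qed

text \<open>If \<open>0\<close> is a node, then evaluation there forces the coefficient of the constant power to be \<open>0\<close>,
  and the remaining exponents interpolate at the remaining, positive nodes. The factor missing
  from the product exceeds \<open>1\<close>, so the bound is even strict.\<close>

lemma power_interpolation:
  fixes n :: "'a \<Rightarrow> real"
  assumes J: "finite J" "inj_on n J" "\<And>j. j \<in> J \<Longrightarrow> n j < M"
    and U: "finite U" "card U = card J" "U \<subseteq> {0..R}" and R: "0 < R"
    and zero: "0 \<in> U \<Longrightarrow> (\<exists>j\<in>J. n j = 0) \<and> (\<forall>j\<in>J. 0 \<le> n j)"
  shows "\<exists>b. (\<forall>x\<in>U. rp x M = (\<Sum>j\<in>J. b j * rp x (n j))) \<and>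
    (\<forall>j\<in>J. \<bar>b j\<bar> \<le> ratio_prod J n M j * R powr (M - n j) \<and>
      (2 \<le> card J \<longrightarrow> \<bar>b j\<bar> < ratio_prod J n M j * R powr (M - n j)))"
proof (cases "0 \<in> U")
  case False
  then have "U \<subseteq> {0<..R}" using U(3) by (auto simp: order_le_less)
  then show ?thesis using power_interpolation_pos[OF J U(1,2)] by blast
next
  case True
  then obtain i where i: "i \<in> J" "n i = 0" and nn: "\<And>j. j \<in> J \<Longrightarrow> 0 \<le> n j" using zero by blast
  have npos: "0 < n j" if "j \<in> J - {i}" for j
  proof -
    have "n j \<noteq> n i" using that i(1) J(2) by (auto simp: inj_on_def)
    then show ?thesis using nn[of j] i(2) that by auto
  qed
  have "U - {0} \<subseteq> {0<..R}" using U(3) by (auto simp: order_le_less)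
  moreover have "inj_on n (J - {i})" using J(2) by (rule inj_on_subset) auto
  ultimately obtain b where b: "\<And>x. x \<in> U - {0} \<Longrightarrow> rp x M = (\<Sum>j\<in>J - {i}. b j * rp x (n j))"
    and bb: "\<And>j. j \<in> J - {i} \<Longrightarrow> \<bar>b j\<bar> \<le> ratio_prod (J - {i}) n M j * R powr (M - n j)"
    using power_interpolation_pos[of "J - {i}" n M "U - {0}" R] J U True i(1) by auto
  define b' where "b' = b(i := 0)"
  have s: "(\<Sum>j\<in>J. b' j * rp x (n j)) = (\<Sum>j\<in>J - {i}. b j * rp x (n j))" for x
    using J(1) i(1) by (simp add: sum.remove[of J i] b'_def)
  have "rp x M = (\<Sum>j\<in>J. b' j * rp x (n j))" if "x \<in> U" for x
  proof (cases "x = 0")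
    case True
    have "(\<Sum>j\<in>J - {i}. b j * rp 0 (n j)) = 0"
      by (rule sum.neutral) (use npos in force)
    then show ?thesis unfolding s using True J(3)[OF i(1)] i(2) by simp
  qed (use b that s in auto)
  moreover have "\<bar>b' j\<bar> < ratio_prod J n M j * R powr (M - n j)" if "j \<in> J" for j
  proof (cases "j = i")
    case True
    then show ?thesis using ratio_prod_pos[OF J(2,3) that] R by (simp add: b'_def)
  next
    case False
    then have j: "j \<in> J - {i}" using that by simp
    have "0 < ratio_prod (J - {i}) n M j"
      using J(2,3) j by (intro ratio_prod_pos) (auto intro: inj_on_subset)
    then have pos: "0 < ratio_prod (J - {i}) n M j * R powr (M - n j)" using R by simp
    have "1 < \<bar>(M - n i) / (n j - n i)\<bar>" using J(3)[OF that] npos[OF j] i(2) by simp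
    then have "1 * (ratio_prod (J - {i}) n M j * R powr (M - n j))
        < \<bar>(M - n i) / (n j - n i)\<bar> * (ratio_prod (J - {i}) n M j * R powr (M - n j))"
      using pos by (rule mult_strict_right_mono)
    also have "\<dots> = ratio_prod J n M j * R powr (M - n j)"
      using ratio_prod_remove[OF J(1) i(1), of j n M] False by simp
    finally show ?thesis using bb[OF j] False by (simp add: b'_def)
  qed
  ultimately show ?thesis by (intro exI[of _ b']) (auto intro: less_imp_le)
qed

text \<open>The constant \<open>\<C>\<close> of the theorem, for an arbitrary index set of exponents, so that exponents
  can be dropped in inductions; \<open>threshold_eq\<close> below identifies the two.\<close>

definition sharp_const :: "'a set \<Rightarrow> ('a \<Rightarrow> real) \<Rightarrow> real \<Rightarrow> ('a \<Rightarrow> real) \<Rightarrow> real \<Rightarrow> real" where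
  "sharp_const J n M c r = (\<Sum>j\<in>J. (ratio_prod J n M j)\<^sup>2 * (r powr (M - n j) / c j))"

text \<open>Writing \<open>x\<^sup>M\<close> as an interpolating combination turns the left-hand sum into a combination of the
  power sums with exponents \<open>n j\<close>; then apply the Cauchy-Schwarz inequality with weights \<open>c j\<close>.
  The constant \<open>q\<close> depends on the nodes but not on the weights \<open>w\<close>, which preserves
  strictness.\<close>

lemma power_sum_bound:
  fixes n c :: "'a \<Rightarrow> real"
  assumes J: "finite J" "inj_on n J" "\<And>j. j \<in> J \<Longrightarrow> n j < M" and c: "\<And>j. j \<in> J \<Longrightarrow> 0 < c j"
    and U: "finite U" "card U = card J" "U \<subseteq> {0..sqrt r}" and r: "0 < r"
    and zero: "0 \<in> U \<Longrightarrow> (\<exists>j\<in>J. n j = 0) \<and> (\<forall>j\<in>J. 0 \<le> n j)"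
  shows "\<exists>q. q \<le> sharp_const J n M c r \<and> (2 \<le> card J \<longrightarrow> q < sharp_const J n M c r) \<and>
    (\<forall>w. (\<Sum>x\<in>U. w x * rp x M)\<^sup>2 \<le> q * (\<Sum>j\<in>J. c j * (\<Sum>x\<in>U. w x * rp x (n j))\<^sup>2))"
proof -
  obtain b where b: "\<And>x. x \<in> U \<Longrightarrow> rp x M = (\<Sum>j\<in>J. b j * rp x (n j))"
    and bb: "\<And>j. j \<in> J \<Longrightarrow> \<bar>b j\<bar> \<le> ratio_prod J n M j * sqrt r powr (M - n j)"
    and bs: "\<And>j. j \<in> J \<Longrightarrow> 2 \<le> card J \<Longrightarrow> \<bar>b j\<bar> < ratio_prod J n M j * sqrt r powr (M - n j)"
    using power_interpolation[OF J U _ zero] r by auto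
  define q where "q = (\<Sum>j\<in>J. (b j)\<^sup>2 / c j)"
  have sq: "(ratio_prod J n M j)\<^sup>2 * (r powr (M - n j) / c j)
      = (ratio_prod J n M j * sqrt r powr (M - n j))\<^sup>2 / c j" for j
    using r by (simp add: power_mult_distrib power2_eq_square[of "sqrt r powr _"] powr_mult[symmetric])
  have "q \<le> sharp_const J n M c r"
    unfolding q_def sharp_const_def sq
  proof (intro sum_mono divide_right_mono)
    fix j assume j: "j \<in> J"
    show "(b j)\<^sup>2 \<le> (ratio_prod J n M j * sqrt r powr (M - n j))\<^sup>2"
      using power_mono[OF bb[OF j], of 2] by simp
  qed (use c in \<open>auto intro: less_imp_le\<close>)
  moreover have "q < sharp_const J n M c r" if "2 \<le> card J"
    unfolding q_def sharp_const_def sq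
  proof (intro sum_strict_mono divide_strict_right_mono)
    fix j assume j: "j \<in> J"
    show "(b j)\<^sup>2 < (ratio_prod J n M j * sqrt r powr (M - n j))\<^sup>2"
      using power_strict_mono[OF bs[OF j that], of 2] by simp
  qed (use c J that in auto)
  moreover have "(\<Sum>x\<in>U. w x * rp x M)\<^sup>2 \<le> q * (\<Sum>j\<in>J. c j * (\<Sum>x\<in>U. w x * rp x (n j))\<^sup>2)" for w
  proof -
    define W where "W j = (\<Sum>x\<in>U. w x * rp x (n j))" for j
    have "(\<Sum>x\<in>U. w x * rp x M) = (\<Sum>x\<in>U. \<Sum>j\<in>J. b j * (w x * rp x (n j)))"
      by (intro sum.cong refl) (simp add: b sum_distrib_left mult_ac)
    also have "\<dots> = (\<Sum>j\<in>J. b j * W j)" by (subst sum.swap) (simp add: W_def sum_distrib_left)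
    also have "\<dots> = (\<Sum>j\<in>J. (b j / sqrt (c j)) * (sqrt (c j) * W j))"
      using c by (intro sum.cong refl) force
    finally have "(\<Sum>x\<in>U. w x * rp x M)\<^sup>2 = (\<Sum>j\<in>J. (b j / sqrt (c j)) * (sqrt (c j) * W j))\<^sup>2"
      by simp
    also have "\<dots> \<le> (\<Sum>j\<in>J. (b j / sqrt (c j))\<^sup>2) * (\<Sum>j\<in>J. (sqrt (c j) * W j)\<^sup>2)"
      by (rule Cauchy_Schwarz_ineq_sum)
    also have "(\<Sum>j\<in>J. (b j / sqrt (c j))\<^sup>2) = q"
      unfolding q_def by (intro sum.cong refl) (simp add: power_divide c less_imp_le)
    also have "(\<Sum>j\<in>J. (sqrt (c j) * W j)\<^sup>2) = (\<Sum>j\<in>J. c j * (W j)\<^sup>2)"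
      by (intro sum.cong refl) (simp add: power_mult_distrib c less_imp_le)
    finally show ?thesis by (simp add: W_def)
  qed
  ultimately show ?thesis by blast
qed

text \<open>Grouping the indices by the value of \<open>u\<close> gives exponential sums at distinct points \<open>ln x\<close>. The
  value \<open>0\<close> contributes only to the exponent \<open>0\<close>: setting that exponent aside costs one equation,
  and removes one unknown as well.\<close>

lemma power_sums_zero:
  fixes n :: "'a \<Rightarrow> real" and u :: "'b \<Rightarrow> real"
  assumes J: "finite J" "inj_on n J" and S: "finite S" "card S \<le> card J"
    and u: "\<And>k. k \<in> S \<Longrightarrow> 0 \<le> u k" and nn: "0 \<in> u ` S \<Longrightarrow> (\<forall>j\<in>J. 0 \<le> n j)"
    and eq: "\<And>j. j \<in> J \<Longrightarrow> (\<Sum>k\<in>S. v k * rp (u k) (n j)) = 0"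
    and x: "0 < x \<or> x = 0 \<and> (\<exists>j\<in>J. n j = 0)"
  shows "(\<Sum>k\<in>{k \<in> S. u k = x}. v k) = 0"
proof -
  define X where "X = u ` S"
  define w where "w x = (\<Sum>k\<in>{k \<in> S. u k = x}. v k)" for x
  have X: "finite X" "card X \<le> card J"
    using S card_image_le[OF S(1), of u] by (auto simp: X_def)
  have Xnn: "\<And>x. x \<in> X \<Longrightarrow> 0 \<le> x" using u by (auto simp: X_def)
  have grp: "(\<Sum>x\<in>X. w x * rp x e) = (\<Sum>k\<in>S. v k * rp (u k) e)" for e
  proof -
    have "(\<Sum>x\<in>X. w x * rp x e) = (\<Sum>x\<in>X. \<Sum>k\<in>{k \<in> S. u k = x}. v k * rp (u k) e)"
      unfolding w_def sum_distrib_right by (intro sum.cong refl) auto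
    also have "\<dots> = (\<Sum>k\<in>S. v k * rp (u k) e)"
      by (rule sum.group) (use S X in \<open>auto simp: X_def\<close>)
    finally show ?thesis .
  qed
  define K where "K = (if 0 \<in> X then {j \<in> J. n j \<noteq> 0} else J)"
  have KJ: "K \<subseteq> J" "finite K" "inj_on n K"
    using J by (auto simp: K_def intro: inj_on_subset finite_subset)
  have z: "(\<Sum>x\<in>X - {0}. w x * exp (ln x * n j)) = 0" if "j \<in> K" for j
  proof -
    have "(\<Sum>x\<in>X - {0}. w x * exp (ln x * n j)) = (\<Sum>x\<in>X - {0}. w x * rp x (n j))"
    proof (intro sum.cong refl)
      fix x assume "x \<in> X - {0}"
      then have "0 < x" using Xnn by (auto simp: order_le_less)
      then show "w x * exp (ln x * n j) = w x * rp x (n j)" by (simp add: rp_exp mult.commute)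
    qed
    also have "\<dots> = (\<Sum>x\<in>X. w x * rp x (n j))"
      by (rule sum.mono_neutral_left) (use X that in \<open>auto simp: K_def\<close>)
    finally show ?thesis using grp eq that KJ(1) by auto
  qed
  have card_le: "card (X - {0}) \<le> card (n ` K)"
  proof (cases "0 \<in> X")
    case False
    then show ?thesis using X KJ by (simp add: K_def card_image)
  next
    case True
    have "card {j \<in> J. n j = 0} \<le> 1"
      using J by (subst One_nat_def, subst card_le_Suc0_iff_eq) (auto simp: inj_on_def)
    moreover have "card J = card K + card {j \<in> J. n j = 0}"
      using J(1) True by (subst card_Un_disjoint[symmetric]) (auto simp: K_def intro!: arg_cong[of _ _ card])
    ultimately have "card J \<le> card K + 1" by simp
    then show ?thesis using X True KJ(3) by (simp add: card_image)
  qed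
  have pos: "w y = 0" if "y \<in> X - {0}" for y
  proof (rule exp_poly_zero[of "X - {0}" ln "n ` K" w])
    show "inj_on ln (X - {0})" using Xnn by (intro inj_onI) (metis DiffE insertI1 ln_inj_iff order_le_less)
  qed (use X KJ z card_le that in auto)
  show ?thesis
  proof (cases "x \<in> X")
    case False
    then have "{k \<in> S. u k = x} = {}" by (auto simp: X_def)
    then show ?thesis by (simp only: sum.empty)
  next
    case True
    show ?thesis
    proof (cases "x = 0")
      case False
      then show ?thesis using pos True by (simp add: w_def)
    next
      case x0: True
      then obtain j where j: "j \<in> J" "n j = 0" using x by auto
      have "(\<Sum>x\<in>X. w x) = 0" using grp[of 0] eq[OF j(1)] j(2) by simp
      moreover have "(\<Sum>x\<in>X. w x) = w 0" using X(1) True x0 pos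
        by (simp add: sum.remove[of X 0])
      ultimately show ?thesis using x0 by (simp add: w_def)
    qed
  qed
qed

text \<open>Repeated values of \<open>u\<close> are merged, and the set of values is enlarged by new nodes of weight \<open>0\<close>
  until there are as many nodes as exponents. The value \<open>0\<close> is kept as a node only if \<open>0\<close> is
  one of the exponents; otherwise its powers all vanish.\<close>

lemma rank_one_bound:
  fixes n c :: "'a \<Rightarrow> real" and u :: "'b \<Rightarrow> real"
  assumes J: "finite J" "inj_on n J" "\<And>j. j \<in> J \<Longrightarrow> n j < M" and c: "\<And>j. j \<in> J \<Longrightarrow> 0 < c j"
    and S: "finite S" "card S \<le> card J" and u: "\<And>k. k \<in> S \<Longrightarrow> u k \<in> {0..sqrt r}" and r: "0 < r"
    and nn: "0 \<in> u ` S \<Longrightarrow> \<forall>j\<in>J. 0 \<le> n j"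
  shows "(\<Sum>k\<in>S. v k * rp (u k) M)\<^sup>2
    \<le> sharp_const J n M c r * (\<Sum>j\<in>J. c j * (\<Sum>k\<in>S. v k * rp (u k) (n j))\<^sup>2)"
proof -
  define Z where "Z \<longleftrightarrow> 0 \<in> u ` S \<and> (\<exists>j\<in>J. n j = 0)"
  define X where "X = (if Z then u ` S else u ` S - {0})"
  have "card X \<le> card (u ` S)" unfolding X_def using S(1) by (auto intro: card_mono)
  then have X: "finite X" "card X \<le> card J"
    using S card_image_le[OF S(1), of u] by (auto simp: X_def)
  have XR: "X \<subseteq> {0..sqrt r}" using u by (auto simp: X_def)
  have "infinite ({0<..sqrt r} - X)" using r X(1) by (simp add: Diff_infinite_finite infinite_Ioc)
  then obtain B where B: "finite B" "card B = card J - card X" "B \<subseteq> {0<..sqrt r} - X"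
    using infinite_arbitrarily_large by blast
  define U where "U = X \<union> B"
  have U: "finite U" "card U = card J" "U \<subseteq> {0..sqrt r}"
  proof -
    have "X \<inter> B = {}" using B by auto
    then show "card U = card J" using X B by (simp add: U_def card_Un_disjoint)
  qed (use X B XR in \<open>auto simp: U_def\<close>)
  have zero: "0 \<in> U \<Longrightarrow> (\<exists>j\<in>J. n j = 0) \<and> (\<forall>j\<in>J. 0 \<le> n j)"
    using B nn by (auto simp: U_def X_def Z_def split: if_splits)
  define S0 where "S0 = {k \<in> S. u k \<in> X}"
  define w where "w x = (\<Sum>k\<in>{k \<in> S0. u k = x}. v k)" for x
  have grp: "(\<Sum>x\<in>U. w x * rp x e) = (\<Sum>k\<in>S0. v k * rp (u k) e)" for e
  proof -
    have "(\<Sum>x\<in>U. w x * rp x e) = (\<Sum>x\<in>U. \<Sum>k\<in>{k \<in> S0. u k = x}. v k * rp (u k) e)"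
      unfolding w_def sum_distrib_right by (intro sum.cong refl) auto
    also have "\<dots> = (\<Sum>k\<in>S0. v k * rp (u k) e)"
      by (rule sum.group) (use S U in \<open>auto simp: S0_def U_def\<close>)
    finally show ?thesis .
  qed
  have drop: "(\<Sum>k\<in>S0. v k * rp (u k) e) = (\<Sum>k\<in>S. v k * rp (u k) e)" if e: "e = M \<or> e \<in> n ` J" for e
  proof (rule sum.mono_neutral_left)
    show "\<forall>k\<in>S - S0. v k * rp (u k) e = 0"
    proof
      fix k assume k: "k \<in> S - S0"
      then have l: "u k = 0" "\<not> Z" by (auto simp: S0_def X_def split: if_splits)
      then have "\<forall>j\<in>J. 0 < n j" using nn k by (force simp: Z_def order_le_less)
      moreover have "J \<noteq> {}" using k S by auto
      ultimately have "e \<noteq> 0" using e J(3) by force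
      then show "v k * rp (u k) e = 0" using l by simp
    qed
  qed (use S in \<open>auto simp: S0_def\<close>)
  obtain q where q: "q \<le> sharp_const J n M c r"
    and *: "\<And>w. (\<Sum>x\<in>U. w x * rp x M)\<^sup>2 \<le> q * (\<Sum>j\<in>J. c j * (\<Sum>x\<in>U. w x * rp x (n j))\<^sup>2)"
    using power_sum_bound[where c = c, OF J c U r zero] by blast
  have "(\<Sum>k\<in>S. v k * rp (u k) M)\<^sup>2 \<le> q * (\<Sum>j\<in>J. c j * (\<Sum>k\<in>S. v k * rp (u k) (n j))\<^sup>2)"
    using *[of w] unfolding grp by (simp add: drop)
  also have "\<dots> \<le> sharp_const J n M c r * (\<Sum>j\<in>J. c j * (\<Sum>k\<in>S. v k * rp (u k) (n j))\<^sup>2)"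
    using q by (intro mult_right_mono sum_nonneg mult_nonneg_nonneg) (simp_all add: c less_imp_le)
  finally show ?thesis .
qed

lemma rank_one_bound_strict:
  fixes n c :: "'a \<Rightarrow> real" and u :: "'b \<Rightarrow> real"
  assumes J: "finite J" "inj_on n J" "\<And>j. j \<in> J \<Longrightarrow> n j < M" and c: "\<And>j. j \<in> J \<Longrightarrow> 0 < c j"
    and S: "finite S" "card S = card J" "2 \<le> card J"
    and u: "\<And>k. k \<in> S \<Longrightarrow> u k \<in> {0..sqrt r}" "inj_on u S" and r: "0 < r"
    and zero: "0 \<in> u ` S \<Longrightarrow> (\<exists>j\<in>J. n j = 0) \<and> (\<forall>j\<in>J. 0 \<le> n j)"
    and v: "l \<in> S" "v l \<noteq> 0"
  shows "(\<Sum>k\<in>S. v k * rp (u k) M)\<^sup>2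
    < sharp_const J n M c r * (\<Sum>j\<in>J. c j * (\<Sum>k\<in>S. v k * rp (u k) (n j))\<^sup>2)"
proof -
  define Q where "Q = (\<Sum>j\<in>J. c j * (\<Sum>k\<in>S. v k * rp (u k) (n j))\<^sup>2)"
  define w where "w = v \<circ> the_inv_into S u"
  have U: "finite (u ` S)" "card (u ` S) = card J" "u ` S \<subseteq> {0..sqrt r}"
    using S u by (auto simp: card_image)
  have grp: "(\<Sum>x\<in>u ` S. w x * rp x e) = (\<Sum>k\<in>S. v k * rp (u k) e)" for e
    using u(2) by (simp add: sum.reindex w_def the_inv_into_f_f)
  obtain q where q: "q < sharp_const J n M c r"
    and *: "\<And>w. (\<Sum>x\<in>u ` S. w x * rp x M)\<^sup>2 \<le> q * (\<Sum>j\<in>J. c j * (\<Sum>x\<in>u ` S. w x * rp x (n j))\<^sup>2)"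
    using power_sum_bound[where c = c, OF J c U r zero] S(3) by blast
  have Q0: "0 \<le> Q" unfolding Q_def by (intro sum_nonneg mult_nonneg_nonneg) (simp_all add: c less_imp_le)
  have "Q \<noteq> 0"
  proof
    assume "Q = 0"
    then have "c j * (\<Sum>k\<in>S. v k * rp (u k) (n j))\<^sup>2 = 0" if "j \<in> J" for j
      using that J(1) unfolding Q_def by (subst (asm) sum_nonneg_eq_0_iff) (auto simp: c less_imp_le)
    then have "(\<Sum>k\<in>S. v k * rp (u k) (n j)) = 0" if "j \<in> J" for j
      using that c by fastforce
    then have "(\<Sum>k\<in>{k \<in> S. u k = u l}. v k) = 0"
      using J S u zero v(1) by (intro power_sums_zero[of J n S]) force+
    moreover have "{k \<in> S. u k = u l} = {l}" using u(2) v(1) by (auto simp: inj_on_def)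
    ultimately show False using v(2) by simp
  qed
  then have "q * Q < sharp_const J n M c r * Q" using q Q0 by (intro mult_strict_right_mono) auto
  moreover have "(\<Sum>k\<in>S. v k * rp (u k) M)\<^sup>2 \<le> q * Q"
    using *[of w] unfolding grp Q_def .
  ultimately show ?thesis by (simp add: Q_def)
qed

section \<open>The sharp inequality for all positive semidefinite matrices\<close>

text \<open>The last term is subtracted, so that \<open>q = 1 / \<C>\<close> is the critical case \<open>g\<close>, and \<open>q = - c'\<close> gives
  \<open>f\<close>.\<close>

definition fewnomial :: "nat set \<Rightarrow> (nat \<Rightarrow> real) \<Rightarrow> (nat \<Rightarrow> real) \<Rightarrow> real \<Rightarrow> real \<Rightarrow> real \<Rightarrow> real" where
  "fewnomial J n c q M x = (\<Sum>j\<in>J. c j * rp x (n j)) - q * rp x M"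

lemma qform_fewnomial:
  "qform S (\<lambda>i k. fewnomial J n c q M (a i k)) v
    = (\<Sum>j\<in>J. c j * qform S (\<lambda>i k. rp (a i k) (n j)) v) - q * qform S (\<lambda>i k. rp (a i k) M) v"
  by (simp add: fewnomial_def qform_diff qform_sum qform_scale)

lemma fewnomial_deriv:
  assumes "0 < x"
  shows "(fewnomial J n c q M has_real_derivative
      fewnomial J (\<lambda>j. n j - 1) (\<lambda>j. c j * n j) (q * M) (M - 1) x) (at x)"
proof -
  have "((\<lambda>x. (\<Sum>j\<in>J. c j * rp x (n j)) - q * rp x M) has_real_derivative
      (\<Sum>j\<in>J. c j * (n j * rp x (n j - 1))) - q * (M * rp x (M - 1))) (at x)"
    using assms by (intro DERIV_diff DERIV_sum DERIV_cmult rp_deriv)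
  then show ?thesis by (simp add: fewnomial_def[abs_def] mult.assoc)
qed

lemma sharp_const_nonneg:
  assumes "\<And>j. j \<in> J \<Longrightarrow> 0 < c j"
  shows "0 \<le> sharp_const J n M c r"
  unfolding sharp_const_def
  by (intro sum_nonneg mult_nonneg_nonneg divide_nonneg_pos) (simp_all add: assms)

lemma sharp_const_pos:
  assumes "finite J" "J \<noteq> {}" "inj_on n J" "\<And>j. j \<in> J \<Longrightarrow> n j < M" "\<And>j. j \<in> J \<Longrightarrow> 0 < c j" "0 < r"
  shows "0 < sharp_const J n M c r"
  unfolding sharp_const_def
proof (rule sum_pos)
  fix j assume "j \<in> J"
  then show "0 < (ratio_prod J n M j)\<^sup>2 * (r powr (M - n j) / c j)"
    using ratio_prod_pos[of n J M j] assms by simp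
qed (use assms in auto)

text \<open>Removing the least exponent deletes one positive summand and divides each of the others by
  \<open>((M - n i) / (n j - n i))\<^sup>2 \<ge> 1\<close>.\<close>

lemma sharp_const_remove:
  assumes J: "finite J" "inj_on n J" "\<And>j. j \<in> J \<Longrightarrow> n j < M" and c: "\<And>j. j \<in> J \<Longrightarrow> 0 < c j"
    and r: "0 < r" and i: "i \<in> J" "\<And>j. j \<in> J \<Longrightarrow> n i \<le> n j"
  shows "sharp_const (J - {i}) n M c r < sharp_const J n M c r"
proof -
  define g where "g K j = (ratio_prod K n M j)\<^sup>2 * (r powr (M - n j) / c j)" for K j
  have "g (J - {i}) j \<le> g J j" if j: "j \<in> J - {i}" for j
  proof -
    have "n i \<noteq> n j" using i(1) j J(2) by (auto simp: inj_on_def)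
    then have "n i < n j" "n j < M" using i(2)[of j] j J(3)[of j] by auto
    then have "1 \<le> \<bar>(M - n i) / (n j - n i)\<bar>" by simp
    then have "1 * ratio_prod (J - {i}) n M j \<le> \<bar>(M - n i) / (n j - n i)\<bar> * ratio_prod (J - {i}) n M j"
      by (rule mult_right_mono) (auto simp: ratio_prod_def intro!: prod_nonneg)
    also have "\<dots> = ratio_prod J n M j" using ratio_prod_remove[OF J(1) i(1), of j n M] j by auto
    finally have "(ratio_prod (J - {i}) n M j)\<^sup>2 \<le> (ratio_prod J n M j)\<^sup>2"
      by (intro power_mono) (auto simp: ratio_prod_def intro!: prod_nonneg)
    then show ?thesis unfolding g_def using c[of j] j by (intro mult_right_mono) auto
  qed
  then have "(\<Sum>j\<in>J - {i}. g (J - {i}) j) \<le> (\<Sum>j\<in>J - {i}. g J j)" by (rule sum_mono)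
  moreover have "0 < g J i" using ratio_prod_pos[OF J(2,3) i(1)] r c[OF i(1)] by (simp add: g_def)
  ultimately show ?thesis using J(1) i(1) by (simp add: sharp_const_def g_def sum.remove[of J i])
qed

text \<open>The derivative of a fewnomial has exponents \<open>n j - 1\<close> and coefficients \<open>c j * n j\<close>. Without its least
  exponent, its constant is no worse because \<open>M / n j \<le> t \<le> t\<^sup>2\<close> for the ratio
  \<open>t = (M - n i) / (n j - n i)\<close>, when \<open>0 \<le> n i < n j < M\<close>.\<close>

lemma sharp_const_derivative:
  assumes J: "finite J" "inj_on n J" "\<And>j. j \<in> J \<Longrightarrow> n j < M" and c: "\<And>j. j \<in> J \<Longrightarrow> 0 < c j"
    and r: "0 < r" and i: "i \<in> J" "\<And>j. j \<in> J \<Longrightarrow> n i \<le> n j" "0 \<le> n i"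
  shows "M * sharp_const (J - {i}) (\<lambda>j. n j - 1) (M - 1) (\<lambda>j. c j * n j) r \<le> sharp_const J n M c r"
proof -
  define g where "g j = (ratio_prod J n M j)\<^sup>2 * (r powr (M - n j) / c j)" for j
  define g' where "g' j = (ratio_prod (J - {i}) n M j)\<^sup>2 * (r powr (M - n j) / (c j * n j))" for j
  have M0: "0 \<le> M" using i J(3) by force
  have le: "M * g' j \<le> g j" if j: "j \<in> J - {i}" for j
  proof -
    have "n i \<noteq> n j" using i(1) j J(2) by (auto simp: inj_on_def)
    then have lt: "n i < n j" "n j < M" using i(2)[of j] j J(3)[of j] by auto
    have nj: "0 < n j" using lt(1) i(3) by simp
    define t where "t = (M - n i) / (n j - n i)"
    have t1: "1 \<le> t" using lt by (simp add: t_def)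
    have "M * (n j - n i) \<le> n j * (M - n i)"
      using mult_right_mono[of "n j" M "n i"] lt i(3) by (simp add: algebra_simps)
    then have "M / n j \<le> t" using lt nj by (simp add: t_def field_simps)
    also have "t \<le> t\<^sup>2" using t1 mult_left_mono[of 1 t t] by (simp add: power2_eq_square)
    finally have "M / n j \<le> t\<^sup>2" .
    then have "M / n j * ((ratio_prod (J - {i}) n M j)\<^sup>2 * (r powr (M - n j) / c j))
        \<le> t\<^sup>2 * ((ratio_prod (J - {i}) n M j)\<^sup>2 * (r powr (M - n j) / c j))"
      using c[of j] j by (intro mult_right_mono) auto
    also have "\<dots> = g j"
    proof -
      have "ratio_prod J n M j = \<bar>t\<bar> * ratio_prod (J - {i}) n M j"
        unfolding t_def by (rule ratio_prod_remove[OF J(1) i(1)]) (use j in auto)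
      then show ?thesis by (simp add: g_def power_mult_distrib mult.assoc)
    qed
    also have "M / n j * ((ratio_prod (J - {i}) n M j)\<^sup>2 * (r powr (M - n j) / c j)) = M * g' j"
      by (simp add: g'_def)
    finally show ?thesis .
  qed
  have "ratio_prod (J - {i}) (\<lambda>j. n j - 1) (M - 1) j = ratio_prod (J - {i}) n M j" for j
    by (simp add: ratio_prod_def)
  then have "sharp_const (J - {i}) (\<lambda>j. n j - 1) (M - 1) (\<lambda>j. c j * n j) r = (\<Sum>j\<in>J - {i}. g' j)"
    by (simp add: sharp_const_def g'_def)
  then have "M * sharp_const (J - {i}) (\<lambda>j. n j - 1) (M - 1) (\<lambda>j. c j * n j) r = (\<Sum>j\<in>J - {i}. M * g' j)"
    by (simp add: sum_distrib_left)
  also have "\<dots> \<le> (\<Sum>j\<in>J - {i}. g j)" by (rule sum_mono) (rule le)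
  also have "\<dots> \<le> (\<Sum>j\<in>J. g j)"
    unfolding g_def by (intro sum_mono2 mult_nonneg_nonneg divide_nonneg_pos) (use J(1) c in auto)
  finally show ?thesis by (simp add: sharp_const_def g_def)
qed

lemma finite_arg_min:
  fixes n :: "'a \<Rightarrow> real"
  assumes "finite J" "J \<noteq> {}"
  obtains i where "i \<in> J" "\<And>j. j \<in> J \<Longrightarrow> n i \<le> n j"
  using arg_min_if_finite[OF assms, of n] by (metis linorder_not_less)

text \<open>The condition of \<^const>\<open>setting3\<close> for matrices with \<open>m\<close> rows. It survives differentiation with
  the loss of one row, because \<open>p\<close> and \<open>m\<close> both drop by \<open>1\<close>.\<close>

definition admissible_exponent :: "nat \<Rightarrow> real \<Rightarrow> bool" where
  "admissible_exponent m p \<longleftrightarrow> p \<in> \<nat> \<union> {real m - 1..}"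

lemma admissible_exponent_pred:
  assumes "admissible_exponent (Suc m) p" "0 < p"
  shows "admissible_exponent m (p - 1)"
proof (cases "p \<in> \<nat>")
  case True
  then obtain q where q: "p = real q" by (auto simp: Nats_def)
  then have "p - 1 = real (q - 1)" using assms(2) by auto
  then show ?thesis by (simp add: admissible_exponent_def)
next
  case False
  then show ?thesis using assms(1) by (auto simp: admissible_exponent_def)
qed

lemma admissible_exponent_mono: "admissible_exponent m p \<Longrightarrow> k \<le> m \<Longrightarrow> admissible_exponent k p"
  by (auto simp: admissible_exponent_def)

lemma admissible_exponent_nonneg: "admissible_exponent m p \<Longrightarrow> 0 < m \<Longrightarrow> 0 \<le> p"
  by (auto simp: admissible_exponent_def Nats_def)

definition sharp_data :: "real \<Rightarrow> nat set \<Rightarrow> (nat \<Rightarrow> real) \<Rightarrow> (nat \<Rightarrow> real) \<Rightarrow> real \<Rightarrow> real \<Rightarrow> bool" where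
  "sharp_data r J n c q M \<longleftrightarrow> finite J \<and> inj_on n J \<and> (\<forall>j\<in>J. n j < M \<and> 0 < c j) \<and> 0 < r \<and>
     0 \<le> q \<and> q * sharp_const J n M c r \<le> 1"

lemma sharp_rank_one:
  assumes D: "sharp_data r J n c q M" and nn: "0 \<in> u ` S \<Longrightarrow> \<forall>j\<in>J. 0 \<le> n j"
    and S: "finite S" "card S \<le> card J" and u: "\<And>k. k \<in> S \<Longrightarrow> u k \<in> {0..sqrt r}"
  shows "0 \<le> qform S (\<lambda>i k. fewnomial J n c q M (u i * u k)) v"
proof -
  have J: "finite J" "inj_on n J" "\<And>j. j \<in> J \<Longrightarrow> n j < M" and c: "\<And>j. j \<in> J \<Longrightarrow> 0 < c j"
    and r: "0 < r" and q: "0 \<le> q" "q * sharp_const J n M c r \<le> 1"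
    using D by (auto simp: sharp_data_def)
  define Q where "Q = (\<Sum>j\<in>J. c j * (\<Sum>k\<in>S. v k * rp (u k) (n j))\<^sup>2)"
  have Q0: "0 \<le> Q" unfolding Q_def by (intro sum_nonneg mult_nonneg_nonneg) (simp_all add: c less_imp_le)
  have "q * (\<Sum>k\<in>S. v k * rp (u k) M)\<^sup>2 \<le> q * (sharp_const J n M c r * Q)"
    unfolding Q_def
    by (rule mult_left_mono[OF rank_one_bound[where c = c, OF J c S u r nn] q(1)]) auto
  also have "\<dots> = (q * sharp_const J n M c r) * Q" by simp
  also have "\<dots> \<le> 1 * Q" by (rule mult_right_mono[OF q(2) Q0])
  finally show ?thesis
    unfolding qform_fewnomial Q_def using u by (simp add: rp_rank_one)
qed

lemma rank_one_root:
  fixes x y d :: real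
  assumes "0 < d"
  shows "x * y / d = (x / sqrt d) * (y / sqrt d)"
  using assms by simp

lemma rank_one_root_range:
  assumes "finite S" "psd S a" "i \<in> S" "a i i > 0" "\<And>j k. j \<in> S \<Longrightarrow> k \<in> S \<Longrightarrow> a j k \<in> {0..r}"
    and "j \<in> S"
  shows "a i j / sqrt (a i i) \<in> {0..sqrt r}"
proof -
  have "(a i j / sqrt (a i i))\<^sup>2 \<in> {0..r}"
    using rank_one_part[OF assms(1-5) assms(6) assms(6)] rank_one_root[OF assms(4), of "a i j" "a i j"]
    by (simp add: power2_eq_square)
  then have "a i j / sqrt (a i i) \<le> sqrt r" by (intro real_le_rsqrt) auto
  moreover have "0 \<le> a i j / sqrt (a i i)" using assms(4) assms(5)[OF assms(3,6)] by simp
  ultimately show ?thesis by simp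
qed

text \<open>This is the induction step from \<open>m\<close> to \<open>m + 1\<close> exponents, with the conclusion for \<open>m\<close> as the
  hypothesis \<open>pres\<close>. The derivative of the fewnomial splits into the power of its least
  exponent, which preserves positivity by itself, and a fewnomial with \<open>m\<close> exponents whose
  constant is small enough. The comparison itself is the conclusion, as it is also needed for
  the strict inequality.\<close>

lemma fewnomial_ge_rank_one:
  fixes S :: "'b set"
  assumes D: "sharp_data r J n c q M" and J: "card J = Suc m" "\<And>j. j \<in> J \<Longrightarrow> admissible_exponent (Suc m) (n j)"
    and S: "finite S" "card S \<le> Suc m" "psd S a" "\<And>j k. j \<in> S \<Longrightarrow> k \<in> S \<Longrightarrow> a j k \<in> {0..r}"
    and i: "i \<in> S" "a i i > 0"
    and pres: "\<And>J n c q M (S :: 'b set) b. sharp_data r J n c q M \<Longrightarrow> card J = m \<Longrightarrow>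
      (\<And>j. j \<in> J \<Longrightarrow> admissible_exponent m (n j)) \<Longrightarrow> finite S \<Longrightarrow> card S \<le> m \<Longrightarrow> psd S b \<Longrightarrow>
      (\<And>j k. j \<in> S \<Longrightarrow> k \<in> S \<Longrightarrow> b j k \<in> {0..r}) \<Longrightarrow> psd S (\<lambda>j k. fewnomial J n c q M (b j k))"
  shows "qform S (\<lambda>j k. fewnomial J n c q M (a i j * a i k / a i i)) v
    \<le> qform S (\<lambda>j k. fewnomial J n c q M (a j k)) v"
proof -
  have fJ: "finite J" "inj_on n J" "\<And>j. j \<in> J \<Longrightarrow> n j < M" and c: "\<And>j. j \<in> J \<Longrightarrow> 0 < c j"
    and r: "0 < r" and q: "0 \<le> q" "q * sharp_const J n M c r \<le> 1"
    using D by (auto simp: sharp_data_def)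
  have J0: "J \<noteq> {}" using J(1) by auto
  have nn: "0 \<le> n j" if "j \<in> J" for j using J(2)[OF that] by (rule admissible_exponent_nonneg) simp
  obtain l where l: "l \<in> J" "\<And>j. j \<in> J \<Longrightarrow> n l \<le> n j" using finite_arg_min[OF fJ(1) J0] by blast
  have M0: "0 < M" using l(1) nn fJ(3) by force
  have npos: "0 < n j" if "j \<in> J - {l}" for j
  proof -
    have "n j \<noteq> n l" using that l(1) fJ(2) by (auto simp: inj_on_def)
    then show ?thesis using l(2)[of j] nn[OF l(1)] that by auto
  qed
  define n' where "n' j = n j - 1" for j
  define c' where "c' j = c j * n j" for j
  have D': "sharp_data r (J - {l}) n' c' (q * M) (M - 1)"
    unfolding sharp_data_def
  proof (intro conjI ballI)
    show "inj_on n' (J - {l})" using fJ(2) by (auto simp: n'_def inj_on_def)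
    have "q * M * sharp_const (J - {l}) n' (M - 1) c' r \<le> q * sharp_const J n M c r"
      unfolding mult.assoc n'_def c'_def
      by (intro mult_left_mono sharp_const_derivative fJ c r l nn q)
    then show "q * M * sharp_const (J - {l}) n' (M - 1) c' r \<le> 1" using q(2) by simp
  qed (use fJ c r q M0 npos in \<open>auto simp: n'_def c'_def\<close>)
  show ?thesis
  proof (rule entrywise_ge_rank_one[OF S(1,3) i S(4) _ fewnomial_deriv])
    show "continuous_on {0..r} (fewnomial J n c q M)"
      unfolding fewnomial_def[abs_def] using nn M0
      by (intro continuous_on_diff continuous_on_sum continuous_on_mult_left rp_continuous) auto
  next
    fix b assume b: "psd (S - {i}) b" "\<And>j k. j \<in> S - {i} \<Longrightarrow> k \<in> S - {i} \<Longrightarrow> b j k \<in> {0..r}"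
    have cS: "card (S - {i}) \<le> m" "finite (S - {i})" using S i(1) by auto
    have rest: "psd (S - {i}) (\<lambda>j k. fewnomial (J - {l}) n' c' (q * M) (M - 1) (b j k))"
    proof (rule pres[OF D'])
      show "card (J - {l}) = m" using J(1) l(1) fJ(1) by simp
      show "admissible_exponent m (n' j)" if "j \<in> J - {l}" for j
        unfolding n'_def using J(2)[of j] npos[OF that] that by (intro admissible_exponent_pred) auto
    qed (use cS b in auto)
    have least: "psd (S - {i}) (\<lambda>j k. c' l * rp (b j k) (n' l))"
    proof (cases "n l = 0")
      case True
      then show ?thesis using psd_rank_one[of "S - {i}" "\<lambda>_. 0"] by (simp add: c'_def)
    next
      case False
      then have "0 < n l" using nn[OF l(1)] by simp
      then have "admissible_exponent (card (S - {i})) (n' l)"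
        unfolding n'_def using J(2)[OF l(1)] cS(1)
        by (blast intro: admissible_exponent_pred admissible_exponent_mono)
      then have "psd (S - {i}) (\<lambda>j k. rp (b j k) (n' l))"
        using b cS by (intro psd_power) (auto simp: admissible_exponent_def)
      then show ?thesis using c[OF l(1)] nn[OF l(1)] by (intro psd_scale) (auto simp: c'_def)
    qed
    have "psd (S - {i}) (\<lambda>j k. c' l * rp (b j k) (n' l)
        + fewnomial (J - {l}) n' c' (q * M) (M - 1) (b j k))"
      by (rule psd_add[OF least rest])
    moreover have "fewnomial J n' c' (q * M) (M - 1) x
        = c' l * rp x (n' l) + fewnomial (J - {l}) n' c' (q * M) (M - 1) x" for x
      using fJ(1) l(1) by (simp add: fewnomial_def sum.remove[of J l])
    ultimately show "psd (S - {i}) (\<lambda>j k. fewnomial J (\<lambda>j. n j - 1) (\<lambda>j. c j * n j) (q * M) (M - 1) (b j k))"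
      by (simp add: n'_def[abs_def] c'_def[abs_def])
  qed
qed

text \<open>The theorem of Khare and Tao: sharpness of the constant on rank one matrices already gives it on
  all positive semidefinite matrices.\<close>

lemma fewnomial_psd:
  assumes "sharp_data r J n c q M" "card J = m" "\<And>j. j \<in> J \<Longrightarrow> admissible_exponent m (n j)"
    and "finite S" "card S \<le> m" "psd S a" "\<And>j k. j \<in> S \<Longrightarrow> k \<in> S \<Longrightarrow> a j k \<in> {0..r}"
  shows "psd S (\<lambda>j k. fewnomial J n c q M (a j k))"
  using assms
proof (induction m arbitrary: J n c q M S a)
  case 0
  then show ?case by (simp add: psd_def qform_def)
next
  case (Suc m)
  have nn: "\<forall>j\<in>J. 0 \<le> n j" using Suc.prems(3) admissible_exponent_nonneg by blast
  have "0 \<le> qform S (\<lambda>j k. fewnomial J n c q M (a j k)) v" for v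
  proof (cases "\<exists>i\<in>S. a i i > 0")
    case False
    have "qform S (\<lambda>j k. fewnomial J n c q M (a j k)) v = qform S (\<lambda>j k. fewnomial J n c q M (0 * 0)) v"
      by (rule qform_cong) (auto simp: no_positive_diag_imp_zero[OF Suc.prems(4,6) False])
    also have "0 \<le> \<dots>"
      by (rule sharp_rank_one[OF Suc.prems(1)])
        (use Suc.prems nn in \<open>auto simp: sharp_data_def\<close>)
    finally show ?thesis .
  next
    case True
    then obtain i where i: "i \<in> S" "a i i > 0" by blast
    define u where "u j = a i j / sqrt (a i i)" for j
    have eq: "a i j * a i k / a i i = u j * u k" for j k
      unfolding u_def by (rule rank_one_root[OF i(2)])
    have u: "u j \<in> {0..sqrt r}" if "j \<in> S" for j
      unfolding u_def by (rule rank_one_root_range[OF Suc.prems(4,6) i Suc.prems(7) that])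
    have "0 \<le> qform S (\<lambda>j k. fewnomial J n c q M (u j * u k)) v"
      by (rule sharp_rank_one[OF Suc.prems(1)]) (use Suc.prems nn u in auto)
    also have "\<dots> \<le> qform S (\<lambda>j k. fewnomial J n c q M (a j k)) v"
      unfolding eq[symmetric]
      by (rule fewnomial_ge_rank_one[OF Suc.prems(1-7) i Suc.IH])
    finally show ?thesis .
  qed
  moreover have "fewnomial J n c q M (a j k) = fewnomial J n c q M (a k j)" if "j \<in> S" "k \<in> S" for j k
    using psd_sym[OF Suc.prems(6) that] by simp
  ultimately show ?case unfolding psd_def by blast
qed

section \<open>Definiteness on a set of representatives\<close>

text \<open>Among the indices with \<open>v i \<noteq> 0\<close> choose one with the largest diagonal entry. If \<open>a i k = a i i\<close> for
  another such \<open>k\<close>, then the \<open>2 \<times> 2\<close> minor forces \<open>a k k = a i i\<close>, which \<open>sep\<close> excludes. So the value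
  \<open>a i i\<close> occurs once in row \<open>i\<close>, and the vanishing power sums of that row give \<open>v i = 0\<close>.\<close>

lemma common_kernel_trivial:
  fixes n :: "nat \<Rightarrow> real" and R :: "'b set"
  assumes R: "finite R" "psd R a" "card R \<le> card J" and J: "finite J" "inj_on n J"
    and nn: "\<And>i k. i \<in> R \<Longrightarrow> k \<in> R \<Longrightarrow> 0 \<le> a i k"
    and zero: "\<And>i k. i \<in> R \<Longrightarrow> k \<in> R \<Longrightarrow> a i k = 0 \<Longrightarrow> \<forall>j\<in>J. 0 \<le> n j"
    and diag: "\<And>i. i \<in> R \<Longrightarrow> a i i = 0 \<Longrightarrow> \<exists>j\<in>J. n j = 0"
    and sep: "\<And>i k. i \<in> R \<Longrightarrow> k \<in> R \<Longrightarrow> a i k = a i i \<Longrightarrow> a k k = a i i \<Longrightarrow> i = k"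
    and ker: "\<And>i j. i \<in> R \<Longrightarrow> j \<in> J \<Longrightarrow> (\<Sum>k\<in>R. rp (a i k) (n j) * v k) = 0"
    and k: "k \<in> R"
  shows "v k = 0"
proof (rule ccontr)
  assume "v k \<noteq> 0"
  define T where "T = {k \<in> R. v k \<noteq> 0}"
  have T: "finite T" "T \<noteq> {}" "T \<subseteq> R" using R(1) k \<open>v k \<noteq> 0\<close> by (auto simp: T_def)
  obtain i where i: "i \<in> T" and min: "\<And>k. k \<in> T \<Longrightarrow> - a i i \<le> - a k k"
    by (rule finite_arg_min[OF T(1,2), of "\<lambda>k. - a k k"]) blast
  have max: "a k k \<le> a i i" if "k \<in> T" for k using min[OF that] by simp
  have iR: "i \<in> R" using i T by auto
  have "(\<Sum>k\<in>{k \<in> T. a i k = a i i}. v k) = 0"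
  proof (rule power_sums_zero[OF J T(1)])
    show "card T \<le> card J" using card_mono[OF R(1) T(3)] R(3) by simp
    show "(\<Sum>k\<in>T. v k * rp (a i k) (n j)) = 0" if "j \<in> J" for j
    proof -
      have "(\<Sum>k\<in>T. v k * rp (a i k) (n j)) = (\<Sum>k\<in>R. rp (a i k) (n j) * v k)"
        using R(1) by (intro sum.mono_neutral_cong_left) (auto simp: T_def)
      then show ?thesis using ker[OF iR that] by simp
    qed
    show "0 < a i i \<or> a i i = 0 \<and> (\<exists>j\<in>J. n j = 0)"
      using nn[OF iR iR] diag[OF iR] by (auto simp: order_le_less)
    show "0 \<in> a i ` T \<Longrightarrow> \<forall>j\<in>J. 0 \<le> n j" using zero[OF iR] T(3) by auto
  qed (use nn iR T in auto)
  moreover have "{k \<in> T. a i k = a i i} = {i}"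
  proof -
    have "k = i" if k: "k \<in> T" "a i k = a i i" for k
    proof -
      have kR: "k \<in> R" using k T by auto
      have "a i i * a i i \<le> a i i * a k k"
        using psd_minor[OF R(1,2) iR kR] k(2) by (simp add: power2_eq_square)
      then have "a i i \<le> a k k" using nn[OF iR iR] nn[OF kR kR]
        by (cases "a i i = 0") auto
      then show ?thesis using sep[OF iR kR k(2)] max[OF k(1)] by simp
    qed
    then show ?thesis using i by auto
  qed
  ultimately show False using i by (simp add: T_def)
qed

text \<open>What the three settings say about a single matrix: either \<open>a\<close> has rank one, and then the only
  condition is that zero entries exclude negative exponents, or the exponents are admissible.\<close>

definition regime :: "nat \<Rightarrow> real \<Rightarrow> (nat \<Rightarrow> real) \<Rightarrow> real \<Rightarrow> (nat \<Rightarrow> nat \<Rightarrow> real) \<Rightarrow> bool" where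
  "regime N r n M a \<longleftrightarrow>
     (\<exists>u. (\<forall>k<N. u k \<in> {0..sqrt r}) \<and> (\<forall>j<N. \<forall>k<N. a j k = u j * u k)
        \<and> (0 \<in> u ` {..<N} \<longrightarrow> (\<forall>j<N. 0 \<le> n j))) \<or>
     (\<forall>j<N. admissible_exponent N (n j)) \<and> admissible_exponent N M"

lemma regime_power_psd:
  assumes "regime N r n M a" "psd {..<N} a" "\<And>j k. j < N \<Longrightarrow> k < N \<Longrightarrow> a j k \<in> {0..r}"
    and "S \<subseteq> {..<N}" "p = M \<or> p \<in> n ` {..<N}"
  shows "psd S (\<lambda>j k. rp (a j k) p)"
proof -
  have "psd {..<N} (\<lambda>j k. rp (a j k) p)"
    using assms(1) unfolding regime_def
  proof (elim disjE exE conjE)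
    fix u assume u: "\<forall>k<N. u k \<in> {0..sqrt r}" "\<forall>j<N. \<forall>k<N. a j k = u j * u k"
    have "psd {..<N} (\<lambda>j k. rp (a j k) p) = psd {..<N} (\<lambda>j k. rp (u j * u k) p)"
      by (rule psd_cong) (use u in auto)
    moreover have "psd {..<N} (\<lambda>j k. rp (u j * u k) p)" using u by (intro psd_rp_rank_one) auto
    ultimately show ?thesis by simp
  next
    assume "\<forall>j<N. admissible_exponent N (n j)" "admissible_exponent N M"
    then show ?thesis
      using assms by (intro psd_power) (auto simp: admissible_exponent_def)
  qed
  then show ?thesis by (rule psd_subset[rotated 2]) (use assms in auto)
qed

lemma regime_fewnomial_nonneg:
  assumes "regime N r n M a" "psd {..<N} a" "\<And>j k. j < N \<Longrightarrow> k < N \<Longrightarrow> a j k \<in> {0..r}"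
    and "S \<subseteq> {..<N}" "J \<subseteq> {..<N}" "card S \<le> card J" "sharp_data r J n c q M"
  shows "0 \<le> qform S (\<lambda>j k. fewnomial J n c q M (a j k)) v"
  using assms(1) unfolding regime_def
proof (elim disjE exE conjE)
  fix u assume u: "\<forall>k<N. u k \<in> {0..sqrt r}" "\<forall>j<N. \<forall>k<N. a j k = u j * u k"
    "0 \<in> u ` {..<N} \<longrightarrow> (\<forall>j<N. 0 \<le> n j)"
  have "qform S (\<lambda>j k. fewnomial J n c q M (a j k)) v = qform S (\<lambda>j k. fewnomial J n c q M (u j * u k)) v"
    by (rule qform_cong) (use u assms(4) in \<open>auto simp: subset_iff\<close>)
  also have "0 \<le> \<dots>"
    by (rule sharp_rank_one[OF assms(7)]) (use u assms(4-6) in \<open>auto intro: finite_subset\<close>)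
  finally show ?thesis .
next
  assume adm: "\<forall>j<N. admissible_exponent N (n j)" "admissible_exponent N M"
  have "card J \<le> N" using card_mono[OF finite_lessThan assms(5)] by simp
  then have "psd S (\<lambda>j k. fewnomial J n c q M (a j k))"
    using assms adm psd_subset[OF finite_lessThan assms(4,2)]
    by (intro fewnomial_psd[OF assms(7) refl]) (auto intro: finite_subset admissible_exponent_mono)
  then show ?thesis by (rule psd_nonneg)
qed

text \<open>If \<open>a\<close> has rank one, then it coincides with its comparison matrix.\<close>

lemma regime_ge_rank_one:
  assumes "regime N r n M a" "psd {..<N} a" "\<And>j k. j < N \<Longrightarrow> k < N \<Longrightarrow> a j k \<in> {0..r}"
    and "sharp_data r {..<N} n c q M" "i < N" "0 < a i i"
  shows "qform {..<N} (\<lambda>j k. fewnomial {..<N} n c q M (a i j * a i k / a i i)) v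
    \<le> qform {..<N} (\<lambda>j k. fewnomial {..<N} n c q M (a j k)) v"
  using assms(1) unfolding regime_def
proof (elim disjE exE conjE)
  fix u assume u: "\<forall>k<N. u k \<in> {0..sqrt r}" "\<forall>j<N. \<forall>k<N. a j k = u j * u k"
  then have "a i j * a i k / a i i = a j k" if "j < N" "k < N" for j k
    using that assms(5,6) by auto
  then show ?thesis by (intro eq_refl qform_cong) auto
next
  assume adm: "\<forall>j<N. admissible_exponent N (n j)" "admissible_exponent N M"
  obtain m where m: "N = Suc m" using assms(5) by (cases N) auto
  show ?thesis
  proof (rule fewnomial_ge_rank_one[OF assms(4), of m])
    show "psd S (\<lambda>j k. fewnomial J n c q M (b j k))"
      if "sharp_data r J n c q M" "card J = m" "\<And>j. j \<in> J \<Longrightarrow> admissible_exponent m (n j)"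
        "finite S" "card S \<le> m" "psd S b" "\<And>j k. j \<in> S \<Longrightarrow> k \<in> S \<Longrightarrow> b j k \<in> {0..r}"
      for J n c q M and S :: "nat set" and b
      by (rule fewnomial_psd[OF that])
  qed (use assms adm m in auto)
qed

text \<open>Below the critical value \<open>q = 1 / \<C>\<close>, or with fewer than \<open>N\<close> rows, the form dominates a positive
  multiple of the form \<open>H\<close> of the sum without \<open>x\<^sup>M\<close>, and \<open>H\<close> is definite because by \<open>sep\<close> the rows in
  \<open>R\<close> are distinct. At the critical value with all \<open>N\<close> rows, definiteness comes instead from the
  strict rank one inequality for the given row.\<close>

lemma fewnomial_form_definite:
  assumes N: "2 \<le> N" and r: "0 < r" and n: "strict_mono_on {..<N} n" "n (N - 1) < M"
    and c: "\<And>j. j < N \<Longrightarrow> 0 < c j"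
    and a: "regime N r n M a" "psd {..<N} a" "\<And>j k. j < N \<Longrightarrow> k < N \<Longrightarrow> a j k \<in> {0..r}"
    and zero: "\<And>j k. j < N \<Longrightarrow> k < N \<Longrightarrow> a j k = 0 \<Longrightarrow> \<forall>j<N. 0 \<le> n j"
    and diag: "\<And>j. j < N \<Longrightarrow> a j j = 0 \<Longrightarrow> n 0 = 0"
    and R: "R \<subseteq> {..<N}"
    and sep: "\<And>i k. i \<in> R \<Longrightarrow> k \<in> R \<Longrightarrow> a i k = a i i \<Longrightarrow> a k k = a i i \<Longrightarrow> i = k"
    and q: "q * sharp_const {..<N} n M c r < 1 \<or> q * sharp_const {..<N} n M c r = 1 \<and>
      (card R < N \<or> (\<exists>i<N. inj_on (a i) {..<N} \<and> ((\<exists>k<N. a i k = 0) \<longrightarrow> n 0 = 0)))"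
    and form0: "qform R (\<lambda>j k. fewnomial {..<N} n c q M (a j k)) v = 0" and k: "k \<in> R"
  shows "v k = 0"
proof -
  define C where "C = sharp_const {..<N} n M c r"
  have inj: "inj_on n {..<N}" using n(1) by (rule strict_mono_on_imp_inj_on)
  have le: "n i \<le> n j" if "i \<le> j" "j < N" for i j
    using that strict_mono_onD[OF n(1), of i j] by (cases "i = j") auto
  have ltM: "n j < M" if "j < N" for j using le[of j "N - 1"] that n(2) by force
  have C0: "0 < C" unfolding C_def
    using N inj ltM c r by (intro sharp_const_pos) (auto simp: lessThan_empty_iff)
  have fR: "finite R" using R finite_subset by blast
  have cR: "card R \<le> N" using card_mono[OF finite_lessThan R] by simp
  define Q where "Q p = qform R (\<lambda>j k. rp (a j k) p) v" for p
  define H where "H = (\<Sum>j<N. c j * Q (n j))"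
  have pw: "psd R (\<lambda>j k. rp (a j k) p)" if "p = M \<or> p \<in> n ` {..<N}" for p
    by (rule regime_power_psd[OF a R that])
  have Q0: "0 \<le> Q p" if "p = M \<or> p \<in> n ` {..<N}" for p
    unfolding Q_def by (rule psd_nonneg[OF pw[OF that]])
  have form: "qform R (\<lambda>j k. fewnomial J n c q M (a j k)) v = (\<Sum>j\<in>J. c j * Q (n j)) - q * Q M" for J q
    by (simp add: qform_fewnomial Q_def)
  have H0: "0 \<le> H" unfolding H_def
    by (intro sum_nonneg mult_nonneg_nonneg Q0) (auto intro: less_imp_le c)
  have QM: "Q M \<le> sharp_const J n M c r * (\<Sum>j\<in>J. c j * Q (n j))"
    if J: "J \<subseteq> {..<N}" "J \<noteq> {}" "card R \<le> card J" for J
  proof -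
    have fJ: "finite J" "inj_on n J" using J inj by (auto intro: finite_subset inj_on_subset)
    define D where "D = sharp_const J n M c r"
    have D0: "0 < D" unfolding D_def using fJ J r c ltM by (intro sharp_const_pos) auto
    have sd: "sharp_data r J n c (inverse D) M"
      unfolding sharp_data_def using fJ J r c ltM D0 by (auto simp: D_def[symmetric])
    have "0 \<le> (\<Sum>j\<in>J. c j * Q (n j)) - inverse D * Q M"
      unfolding form[symmetric] by (rule regime_fewnomial_nonneg) (fact a R J sd)+
    then show ?thesis using D0 by (simp add: D_def[symmetric] field_simps)
  qed
  \<comment> \<open>Once the given form dominates a positive multiple of \<open>H\<close>, it vanishes only on the common
    kernel of the powers.\<close>
  have finish: "v k = 0" if e: "0 < e" "e * H \<le> H - q * Q M" for e
  proof -
    have "e * H \<le> 0" using e(2) form0 unfolding form H_def by simp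
    then have "H = 0" using e(1) H0 by (simp add: mult_le_0_iff)
    then have cQ: "c j * Q (n j) = 0" if "j < N" for j
      using that c Q0 unfolding H_def
      by (subst (asm) sum_nonneg_eq_0_iff) (auto intro!: mult_nonneg_nonneg less_imp_le[OF c])
    have Qn: "Q (n j) = 0" if "j < N" for j using cQ[OF that] c[OF that] by simp
    show ?thesis
    proof (rule common_kernel_trivial[OF fR psd_subset[OF finite_lessThan R a(2)], of "{..<N}" n])
      show "(\<Sum>k\<in>R. rp (a i k) (n j) * v k) = 0" if "i \<in> R" "j \<in> {..<N}" for i j
        using psd_kernel[OF fR pw, of "n j" i v] Qn[of j] that by (simp add: Q_def)
      show "\<exists>j\<in>{..<N}. n j = 0" if "i \<in> R" "a i i = 0" for i
        using diag[of i] that R N by (intro bexI[of _ 0]) auto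
      show "0 \<le> a i k" if "i \<in> R" "k \<in> R" for i k using a(3)[of i k] that R by auto
      show "\<forall>j\<in>{..<N}. 0 \<le> n j" if "i \<in> R" "k \<in> R" "a i k = 0" for i k
        using zero[of i k] that R by auto
    qed (use cR inj sep k in auto)
  qed
  from q consider "q * C < 1" | "q * C = 1" "card R < N"
    | i where "q * C = 1" "card R = N" "i < N" "inj_on (a i) {..<N}" "(\<exists>k<N. a i k = 0) \<longrightarrow> n 0 = 0"
    using cR unfolding C_def by force
  then show ?thesis
  proof cases
    case 1
    show ?thesis
    proof (cases "q \<le> 0")
      case True
      then have "q * Q M \<le> 0" using Q0[of M] by (simp add: mult_le_0_iff)
      then show ?thesis by (intro finish[of 1]) auto
    next
      case False
      have "q * Q M \<le> q * (C * H)"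
        unfolding C_def H_def using False cR N by (intro mult_left_mono QM) (auto simp: lessThan_empty_iff)
      then show ?thesis using 1 by (intro finish[of "1 - q * C"]) (auto simp: algebra_simps)
    qed
  next
    case 2
    \<comment> \<open>Fewer than \<open>N\<close> rows: the \<open>N - 1\<close> larger exponents already control \<open>M\<close>, with a
      strictly smaller constant.\<close>
    define C' where "C' = sharp_const ({..<N} - {0}) n M c r"
    define H' where "H' = (\<Sum>j\<in>{..<N} - {0}. c j * Q (n j))"
    have "C' < C" unfolding C_def C'_def
      using N inj ltM c r le by (intro sharp_const_remove) auto
    moreover have q0: "0 < q" using 2(1) C0 zero_less_mult_pos2[of q C] by simp
    ultimately have e: "q * C' < 1" using 2(1) by (metis mult_strict_left_mono)
    have "Q M \<le> C' * H'" unfolding C'_def H'_def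
    proof (rule QM)
      have "1 \<in> {..<N} - {0}" using N by simp
      then show "{..<N} - {0} \<noteq> {}" by blast
    qed (use 2 N in auto)
    then have "q * Q M \<le> q * C' * H'" using q0 by simp
    moreover have HH: "H = c 0 * Q (n 0) + H'" unfolding H_def H'_def using N by (subst sum.remove[of _ 0]) auto
    moreover have "0 \<le> c 0 * Q (n 0)" using c[of 0] Q0[of "n 0"] N by (intro mult_nonneg_nonneg) auto
    moreover have "0 \<le> C'" unfolding C'_def using c by (intro sharp_const_nonneg) auto
    then have "0 \<le> q * C'" using q0 by simp
    ultimately have "(1 - q * C') * H \<le> H - q * Q M"
      using mult_nonneg_nonneg[of "q * C'" "c 0 * Q (n 0)"] by (simp add: algebra_simps)
    then show ?thesis using e by (intro finish[of "1 - q * C'"]) auto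
  next
    case (3 i)
    \<comment> \<open>The comparison matrix of the row with distinct entries is built from distinct numbers, so
      there the inequality is strict.\<close>
    have RN: "R = {..<N}" using card_subset_eq[OF finite_lessThan R] 3(2) by simp
    have q0: "0 < q" using 3(1) C0 zero_less_mult_pos2[of q C] by simp
    have D: "sharp_data r {..<N} n c q M"
      unfolding sharp_data_def using inj r c ltM q0 3(1) by (auto simp: C_def[symmetric])
    have "a i i \<noteq> 0"
    proof
      assume "a i i = 0"
      then have "a i 0 = a i 1"
        using psd_zero_diag[OF finite_lessThan a(2), of i] 3(3) N by auto
      then show False using 3(4) N by (auto dest: inj_onD)
    qed
    then have ii: "0 < a i i" using a(3)[OF 3(3) 3(3)] by simp
    have iN: "i \<in> {..<N}" using 3(3) by simp
    define u where "u j = a i j / sqrt (a i i)" for j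
    have eq: "a i j * a i k / a i i = u j * u k" for j k
      unfolding u_def by (rule rank_one_root[OF ii])
    have u: "u j \<in> {0..sqrt r}" if "j \<in> {..<N}" for j
      unfolding u_def by (rule rank_one_root_range[OF finite_lessThan a(2) iN ii _ that]) (use a in auto)
    have "inj_on u {..<N}" using 3(4) ii by (auto simp: u_def inj_on_def)
    show ?thesis
    proof (rule ccontr)
      assume "v k \<noteq> 0"
      define W where "W = (\<Sum>j<N. c j * (\<Sum>k<N. v k * rp (u k) (n j))\<^sup>2)"
      have "(\<Sum>k<N. v k * rp (u k) M)\<^sup>2 < C * W"
        unfolding C_def W_def
      proof (rule rank_one_bound_strict[where c = c and l = k])
        show "(\<exists>j\<in>{..<N}. n j = 0) \<and> (\<forall>j\<in>{..<N}. 0 \<le> n j)" if "0 \<in> u ` {..<N}"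
        proof -
          from that obtain l where l: "l < N" "a i l = 0" using ii by (auto simp: u_def)
          then have "n 0 = 0" "\<forall>j<N. 0 \<le> n j" using 3(5) zero[OF 3(3) l] by auto
          then show ?thesis using N by (auto intro!: bexI[of _ 0])
        qed
      qed (use inj ltM c N u r k RN \<open>inj_on u {..<N}\<close> \<open>v k \<noteq> 0\<close> in auto)
      then have "q * (\<Sum>k<N. v k * rp (u k) M)\<^sup>2 < q * (C * W)" using q0 by simp
      also have "\<dots> = W" using 3(1) by (simp add: mult.assoc[symmetric])
      finally have "0 < W - q * (\<Sum>k<N. v k * rp (u k) M)\<^sup>2" by simp
      also have "\<dots> = qform {..<N} (\<lambda>j k. fewnomial {..<N} n c q M (u j * u k)) v"
      proof -
        have "qform {..<N} (\<lambda>j k. rp (u j * u k) p) v = (\<Sum>k<N. v k * rp (u k) p)\<^sup>2" for p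
          by (rule rp_rank_one) (use u in auto)
        then show ?thesis by (simp add: qform_fewnomial W_def)
      qed
      also have "\<dots> \<le> qform {..<N} (\<lambda>j k. fewnomial {..<N} n c q M (a j k)) v"
        unfolding eq[symmetric] by (rule regime_ge_rank_one[OF a D 3(3) ii])
      finally show False using form0 RN by simp
    qed
  qed
qed

section \<open>The rank of an entrywise image\<close>

text \<open>The minor of \<open>B\<close> on \<open>R\<close> is nonzero; \<open>g\<close> enumerates \<open>R\<close> in increasing order, inversely to \<open>pick\<close>.\<close>

lemma rank_ge_nonsingular_block:
  fixes B :: "complex mat"
  assumes B: "B \<in> carrier_mat N N" and R: "R \<subseteq> {..<N}"
    and ker: "\<And>w k. (\<And>i. i \<in> R \<Longrightarrow> (\<Sum>k\<in>R. B $$ (i, k) * w k) = 0) \<Longrightarrow> k \<in> R \<Longrightarrow> w k = 0"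
  shows "card R \<le> vec_space.rank N B"
proof -
  define g where "g k = card {a \<in> R. a < k}" for k
  have fR: "finite R" using R finite_subset by blast
  have set_eq: "{i. i < N \<and> i \<in> R} = R" using R by auto
  have pick_g: "pick R (g k) = k" if "k \<in> R" for k using that by (simp add: g_def pick_card_in_set)
  have g_lt: "g k < card R" if "k \<in> R" for k
    unfolding g_def using fR that by (intro psubset_card_mono) auto
  have g_pick: "g (pick R x) = x" if "x < card R" for x using that by (simp add: g_def card_pick_le)
  have pick_R: "pick R x \<in> R" if "x < card R" for x using that by (rule pick_in_set_le)
  define D where "D = submatrix B R R"
  have D: "D \<in> carrier_mat (card R) (card R)"
    using B by (intro carrier_matI) (simp_all add: D_def dim_submatrix set_eq)
  have D_idx: "D $$ (x, y) = B $$ (pick R x, pick R y)" if "x < card R" "y < card R" for x y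
    unfolding D_def using B that by (intro submatrix_index) (simp_all add: set_eq)
  have "det D \<noteq> 0"
  proof
    assume "det D = 0"
    then obtain v where v: "v \<in> carrier_vec (card R)" "v \<noteq> 0\<^sub>v (card R)" "D *\<^sub>v v = 0\<^sub>v (card R)"
      using det_0_iff_vec_prod_zero_field[OF D] by blast
    have "(\<Sum>k\<in>R. B $$ (i, k) * v $ g k) = 0" if i: "i \<in> R" for i
    proof -
      have "(\<Sum>k\<in>R. B $$ (i, k) * v $ g k) = (\<Sum>y<card R. B $$ (i, pick R y) * v $ y)"
        by (rule sum.reindex_bij_witness[of _ "pick R" g]) (use pick_g g_lt g_pick pick_R in auto)
      also have "\<dots> = (\<Sum>y<card R. D $$ (g i, y) * v $ y)"
        using D_idx g_lt[OF i] pick_g[OF i] by (intro sum.cong) auto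
      also have "\<dots> = (D *\<^sub>v v) $ g i"
        using D v(1) g_lt[OF i] by (auto simp: scalar_prod_def lessThan_atLeast0 intro!: sum.cong)
      finally show ?thesis using v(3) g_lt[OF i] by simp
    qed
    then have "v $ g k = 0" if "k \<in> R" for k using ker[of "\<lambda>k. v $ g k"] that by blast
    then have "v $ x = 0" if "x < card R" for x using pick_R[OF that] g_pick[OF that] by metis
    then have "v = 0\<^sub>v (card R)" using v(1) by (intro eq_vecI) auto
    with v(2) show False ..
  qed
  then have "card {j. j < N \<and> j \<in> R} \<le> vec_space.rank N B"
    unfolding D_def by (rule vec_space.rank_gt_minor[OF B])
  then show ?thesis by (simp add: set_eq)
qed

lemma rank_ge_definite_block:
  fixes B :: "complex mat" and b :: "nat \<Rightarrow> nat \<Rightarrow> real"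
  assumes B: "B \<in> carrier_mat N N" and R: "R \<subseteq> {..<N}"
    and b: "\<And>i k. i \<in> R \<Longrightarrow> k \<in> R \<Longrightarrow> B $$ (i, k) = complex_of_real (b i k)"
    and def: "\<And>v k. qform R b v = 0 \<Longrightarrow> k \<in> R \<Longrightarrow> v k = 0"
  shows "card R \<le> vec_space.rank N B"
proof (rule rank_ge_nonsingular_block[OF B R])
  fix w k
  assume w: "\<And>i. i \<in> R \<Longrightarrow> (\<Sum>k\<in>R. B $$ (i, k) * w k) = 0" and k: "k \<in> R"
  have z: "(\<Sum>k\<in>R. complex_of_real (b i k) * w k) = 0" if "i \<in> R" for i
    using w[OF that] b[OF that] by simp
  have form: "qform R b x = (\<Sum>i\<in>R. x i * (\<Sum>k\<in>R. b i k * x k))" for x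
    by (simp add: qform_def sum_distrib_left mult_ac)
  have "(\<Sum>k\<in>R. b i k * Re (w k)) = 0" "(\<Sum>k\<in>R. b i k * Im (w k)) = 0" if "i \<in> R" for i
    using arg_cong[OF z[OF that], of Re] arg_cong[OF z[OF that], of Im] by simp_all
  then have "qform R b (\<lambda>k. Re (w k)) = 0" "qform R b (\<lambda>k. Im (w k)) = 0"
    unfolding form by simp_all
  then show "w k = 0" using def[of "\<lambda>k. Re (w k)" k] def[of "\<lambda>k. Im (w k)" k] k
    by (simp add: complex_eq_iff)
qed

lemma rank_le_card_cols:
  fixes B :: "complex mat"
  assumes "B \<in> carrier_mat N N"
  shows "vec_space.rank N B \<le> card (set (cols B))"
proof -
  interpret vec_space "TYPE(complex)" N .
  obtain S where S: "maximal S (\<lambda>T. T \<subseteq> set (cols B) \<and> lin_indpt T)"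
    using maximal_exists_superset[of "set (cols B)" "\<lambda>T. T \<subseteq> set (cols B) \<and> lin_indpt T" "{}"]
    by (auto simp: lin_dep_def)
  then have "rank B = card S" by (rule rank_card_indpt[OF assms])
  moreover have "S \<subseteq> set (cols B)" using S by (simp add: maximal_def)
  ultimately show ?thesis by (simp add: card_mono)
qed

lemma rank_le_blocks:
  fixes A :: "complex mat" and F :: "complex \<Rightarrow> complex"
  assumes A: "A \<in> carrier_mat N N" and p: "block_constant N A p"
  shows "vec_space.rank N (map_mat F A) \<le> card p"
proof -
  define B where "B = map_mat F A"
  have B: "B \<in> carrier_mat N N" using A by (simp add: B_def)
  have part: "partition_on {..<N} p" using p by (simp add: block_constant_def)
  have fp: "finite p" using finite_elements[OF finite_lessThan part] .
  have "set (cols B) \<subseteq> (\<lambda>I. col B (SOME i. i \<in> I)) ` p"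
  proof
    fix x assume "x \<in> set (cols B)"
    then obtain i where i: "i < N" "x = col B i" using B by (auto simp: cols_def)
    then obtain I where I: "I \<in> p" "i \<in> I" using part by (auto simp: partition_on_def)
    define k where "k = (SOME i. i \<in> I)"
    have k: "k \<in> I" unfolding k_def using I(2) by (rule someI)
    then have "k < N" using I(1) part by (auto simp: partition_on_def)
    have "col B i = col B k"
    proof (rule eq_vecI)
      fix l assume "l < dim_vec (col B k)"
      then have l: "l < N" using B by simp
      then obtain L where L: "L \<in> p" "l \<in> L" using part by (auto simp: partition_on_def)
      have "A $$ (l, i) = A $$ (l, k)" using p I k L unfolding block_constant_def by blast
      then show "col B i $ l = col B k $ l"
        using A l i \<open>k < N\<close> by (simp add: B_def)
    qed (use B in simp)
    then show "x \<in> (\<lambda>I. col B (SOME i. i \<in> I)) ` p" using i I(1) by (auto simp: k_def)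
  qed
  then have "card (set (cols B)) \<le> card p" using fp by (meson card_image_le card_mono finite_imageI le_trans)
  then show ?thesis using rank_le_card_cols[OF B] by (simp add: B_def)
qed

text \<open>Having equal rows and columns is an equivalence relation whose quotient is constant on blocks; the
  least such partition has larger blocks.\<close>

lemma equal_lines_same_block:
  assumes i: "i < N" "k < N" and eq: "\<And>l. l < N \<Longrightarrow> A $$ (i, l) = A $$ (k, l) \<and> A $$ (l, i) = A $$ (l, k)"
    and I: "I \<in> partition_of N A" "i \<in> I"
  shows "k \<in> I"
proof -
  define r where "r = {(i, k). i < N \<and> k < N \<and>
    (\<forall>l<N. A $$ (i, l) = A $$ (k, l) \<and> A $$ (l, i) = A $$ (l, k))}"
  have equiv: "equiv {..<N} r"
    unfolding equiv_def refl_on_def sym_def trans_def r_def by auto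
  have rel: "(i, k) \<in> r" if "X \<in> {..<N} // r" "i \<in> X" "k \<in> X" for X i k
    using that quotient_eq_iff[OF equiv] by blast
  have "A $$ (x, y) = A $$ (x', y')"
    if "X \<in> {..<N} // r" "Y \<in> {..<N} // r" "x \<in> X" "x' \<in> X" "y \<in> Y" "y' \<in> Y" for X Y x x' y y'
    using rel[of X x x'] rel[of Y y y'] that by (auto simp: r_def)
  then have bc: "block_constant N A ({..<N} // r)"
    using partition_on_quotient[OF equiv] unfolding block_constant_def by blast
  obtain p where p: "block_constant N A p" "\<And>q. block_constant N A q \<Longrightarrow> part_le N p q"
    using least_block_constant by blast
  have P: "block_constant N A (partition_of N A)"
    "\<And>q. block_constant N A q \<Longrightarrow> part_le N q (partition_of N A) \<Longrightarrow> q = partition_of N A"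
    using minimal_partition_of[of N A] by (auto simp: minimal_block_constant_def)
  have "p = partition_of N A" using P p by blast
  then have "part_le N (partition_of N A) ({..<N} // r)" using p(2)[OF bc] by simp
  moreover have "r `` {i} \<in> {..<N} // r" using i by (auto intro: quotientI)
  ultimately obtain Y where Y: "Y \<in> partition_of N A" "r `` {i} \<subseteq> Y"
    by (auto simp: part_le_def refines_def)
  have "(i, i) \<in> r" "(i, k) \<in> r" using i eq by (auto simp: r_def)
  then have "i \<in> Y" "k \<in> Y" using Y by auto
  then have "Y = I" using P(1) Y(1) I
    unfolding block_constant_def partition_on_def disjoint_def by blast
  then show ?thesis using \<open>k \<in> Y\<close> by simp
qed

lemma block_representatives:
  assumes p: "partition_on {..<N} p"
  obtains R where "R \<subseteq> {..<N}" "card R = card p"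
    "\<And>i k I. I \<in> p \<Longrightarrow> i \<in> R \<inter> I \<Longrightarrow> k \<in> R \<inter> I \<Longrightarrow> i = k"
    "card p = N \<Longrightarrow> p = singletons N"
proof
  define s where "s I = (SOME i. i \<in> I)" for I :: "nat set"
  have s: "s I \<in> I" if "I \<in> p" for I
    using that p unfolding s_def partition_on_def by (metis someI_ex ex_in_conv)
  have dis: "I = K" if "I \<in> p" "K \<in> p" "i \<in> I" "i \<in> K" for I K i
    using that p unfolding partition_on_def disjoint_def by blast
  have sub: "I \<subseteq> {..<N}" if "I \<in> p" for I using that p by (auto simp: partition_on_def)
  have inj: "inj_on s p" using s dis by (metis inj_onI)
  show R: "s ` p \<subseteq> {..<N}" using s sub by blast
  show c: "card (s ` p) = card p" using inj by (rule card_image)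
  show one: "i = k" if I: "I \<in> p" and i: "i \<in> s ` p \<inter> I" and k: "k \<in> s ` p \<inter> I" for i k I
  proof -
    have "x = s I" if x: "x \<in> s ` p \<inter> I" for x
    proof -
      obtain K where K: "K \<in> p" "x = s K" using x by blast
      then show ?thesis using dis[OF K(1) I, of x] s[OF K(1)] x by simp
    qed
    from this[OF i] this[OF k] show ?thesis by simp
  qed
  show "p = singletons N" if "card p = N"
  proof -
    have all: "s ` p = {..<N}" using card_subset_eq[OF finite_lessThan R] c that by simp
    have "I = {s I}" if I: "I \<in> p" for I
    proof -
      have "x = s I" if "x \<in> I" for x
      proof (rule one[OF I])
        show "x \<in> s ` p \<inter> I" "s I \<in> s ` p \<inter> I"
          unfolding all using that sub[OF I] s[OF I] by auto
      qed
      then show ?thesis using s[OF I] by blast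
    qed
    then have "(\<lambda>I. {s I}) ` p = (\<lambda>I. I) ` p" by (intro image_cong) auto
    then have "p = (\<lambda>I. {s I}) ` p" by simp
    also have "\<dots> = (\<lambda>i. {i}) ` (s ` p)" by (simp add: image_image)
    finally show ?thesis by (simp add: singletons_def all)
  qed
qed

text \<open>The difference of the unit vectors of \<open>i\<close> and \<open>k\<close> is a null vector of the form.\<close>

lemma psd_equal_rows:
  assumes S: "finite S" "psd S a" and "i \<in> S" "k \<in> S" "a i k = a i i" "a k k = a i i" "l \<in> S"
  shows "a l i = a l k"
proof (cases "i = k")
  case False
  define v where "v j = (if j = i then 1 else if j = k then - 1 else 0 :: real)" for j
  have "qform S a v = qform {i, k} a v"
    by (rule qform_zero_extend) (use assms in \<open>auto simp: v_def\<close>)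
  also have "\<dots> = 0"
    using False assms psd_sym[OF S(2), of i k] by (simp add: qform_def v_def)
  finally have "(\<Sum>j\<in>S. a l j * v j) = 0" by (rule psd_kernel[OF S assms(7)])
  moreover have "(\<Sum>j\<in>S. a l j * v j) = (\<Sum>j\<in>{i, k}. a l j * v j)"
    by (rule sum.mono_neutral_right) (use assms in \<open>auto simp: v_def\<close>)
  ultimately have "(\<Sum>j\<in>{i, k}. a l j * v j) = 0" by metis
  then have "a l i * v i + a l k * v k = 0" using False by simp
  then show ?thesis using False by (simp add: v_def)
qed simp

section \<open>Vandermonde products and complex positive semidefinite matrices\<close>

lemma rpow_of_real: "0 \<le> x \<Longrightarrow> rpow (complex_of_real x) p = complex_of_real (rp x p)"
  by (simp add: rpow_def rp_def powr_of_real)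

lemma V_snoc: "V (xs @ [y]) = V xs * (\<Prod>x\<leftarrow>xs. y - x)"
proof -
  have "(\<Prod>k<length xs. y - xs ! k) = (\<Prod>x\<leftarrow>xs. y - x)"
    by (simp add: prod.list_conv_set_nth lessThan_atLeast0)
  then show ?thesis by (simp add: V_def nth_append)
qed

text \<open>The square of the Vandermonde product, written without reference to an ordering so that
  elements can be inserted in any order.\<close>

definition pair_prod :: "'a set \<Rightarrow> ('a \<Rightarrow> real) \<Rightarrow> real" where
  "pair_prod S n = (\<Prod>k\<in>S. \<Prod>l\<in>S - {k}. \<bar>n l - n k\<bar>)"

lemma pair_prod_insert:
  assumes "finite S" "y \<notin> S"
  shows "pair_prod (insert y S) n = pair_prod S n * (\<Prod>x\<in>S. n y - n x)\<^sup>2"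
proof -
  have "(\<Prod>l\<in>insert y S - {k}. \<bar>n l - n k\<bar>) = \<bar>n y - n k\<bar> * (\<Prod>l\<in>S - {k}. \<bar>n l - n k\<bar>)"
    if "k \<in> S" for k
  proof -
    have "insert y S - {k} = insert y (S - {k})" using that assms by auto
    then show ?thesis using assms by simp
  qed
  then have "pair_prod (insert y S) n
      = (\<Prod>l\<in>S. \<bar>n l - n y\<bar>) * ((\<Prod>k\<in>S. \<bar>n y - n k\<bar>) * pair_prod S n)"
    using assms by (simp add: pair_prod_def prod.distrib)
  also have "(\<Prod>l\<in>S. \<bar>n l - n y\<bar>) = \<bar>\<Prod>x\<in>S. n y - n x\<bar>" by (simp add: abs_prod abs_minus_commute)
  also have "(\<Prod>k\<in>S. \<bar>n y - n k\<bar>) = \<bar>\<Prod>x\<in>S. n y - n x\<bar>" by (simp add: abs_prod)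
  finally show ?thesis by (simp add: power2_eq_square)
qed

lemma V_square:
  assumes "distinct xs"
  shows "(V (map n xs))\<^sup>2 = pair_prod (set xs) n"
  using assms
proof (induction xs rule: rev_induct)
  case Nil
  then show ?case by (simp add: V_def pair_prod_def)
next
  case (snoc y xs)
  then have "(\<Prod>x\<leftarrow>map n xs. n y - x) = (\<Prod>x\<in>set xs. n y - n x)"
    by (simp add: prod.distinct_set_conv_list o_def)
  then show ?case using snoc by (simp add: V_snoc power_mult_distrib pair_prod_insert)
qed

lemma threshold_eq:
  assumes "inj_on n {..<N}"
  shows "threshold N r n M c = sharp_const {..<N} n M c r"
proof -
  have "(V (omit_append N n M j))\<^sup>2 / (V (map n [0..<N]))\<^sup>2 = (ratio_prod {..<N} n M j)\<^sup>2" if j: "j < N" for j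
  proof -
    define K where "K = {..<N} - {j}"
    define xs where "xs = filter (\<lambda>i. i \<noteq> j) [0..<N]"
    have xs: "distinct xs" "set xs = K" by (auto simp: xs_def K_def)
    have N: "{..<N} = insert j K" "finite K" "j \<notin> K" using j by (auto simp: K_def)
    have ne: "n j \<noteq> n i" if "i \<in> K" for i using assms j that by (auto simp: K_def inj_on_def)
    have "(\<Prod>x\<leftarrow>map n xs. M - x) = (\<Prod>i\<in>K. M - n i)"
      unfolding xs(2)[symmetric] using xs(1) by (simp add: prod.distinct_set_conv_list o_def)
    then have 1: "(V (omit_append N n M j))\<^sup>2 = pair_prod K n * (\<Prod>i\<in>K. M - n i)\<^sup>2"
      using V_square[OF xs(1), of n] xs(2)
      by (simp add: omit_append_def xs_def[symmetric] V_snoc power_mult_distrib)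
    have 2: "(V (map n [0..<N]))\<^sup>2 = pair_prod K n * (\<Prod>i\<in>K. n j - n i)\<^sup>2"
      using V_square[of "[0..<N]" n] N pair_prod_insert[OF N(2,3), of n]
      by (simp add: lessThan_atLeast0)
    have "pair_prod K n \<noteq> 0"
      using N(2) assms by (auto simp: pair_prod_def K_def inj_on_def)
    then have "(V (omit_append N n M j))\<^sup>2 / (V (map n [0..<N]))\<^sup>2 = ((\<Prod>i\<in>K. M - n i) / (\<Prod>i\<in>K. n j - n i))\<^sup>2"
      unfolding 1 2 by (simp add: power_divide)
    also have "\<dots> = (ratio_prod {..<N} n M j)\<^sup>2"
      by (simp add: ratio_prod_def K_def[symmetric] prod_dividef abs_prod[symmetric] del: abs_divide)
    finally show ?thesis .
  qed
  then show ?thesis unfolding threshold_def sharp_const_def by (intro sum.cong) auto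
qed

lemma psd_of_matrix:
  assumes A: "positive_semidefinite N A"
    and real: "\<And>i j. i < N \<Longrightarrow> j < N \<Longrightarrow> A $$ (i, j) = complex_of_real (a i j)"
  shows "psd {..<N} a"
proof -
  have car: "A \<in> carrier_mat N N" and adj: "mat_adjoint A = A"
    and pos: "\<And>v. v \<in> carrier_vec N \<Longrightarrow> 0 \<le> (A *\<^sub>v v) \<bullet>c v"
    using A by (auto simp: positive_semidefinite_def)
  have "a i j = a j i" if "i < N" "j < N" for i j
  proof -
    have "mat_adjoint A $$ (i, j) = conjugate (A $$ (j, i))"
      using car that by (simp add: mat_adjoint_def mat_of_rows_index cols_def)
    then show ?thesis using adj real that by simp
  qed
  moreover have "0 \<le> qform {..<N} a x" for x
  proof -
    define v where "v = vec N (\<lambda>i. complex_of_real (x i))"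
    have v: "v \<in> carrier_vec N" by (simp add: v_def)
    have "(A *\<^sub>v v) \<bullet>c v = (\<Sum>i<N. (\<Sum>j<N. complex_of_real (a i j * x j)) * complex_of_real (x i))"
      using car by (auto simp: scalar_prod_def v_def real lessThan_atLeast0 intro!: sum.cong)
    also have "\<dots> = complex_of_real (qform {..<N} a x)"
      by (simp add: qform_def sum_distrib_left sum_distrib_right mult_ac)
    finally have "0 \<le> complex_of_real (qform {..<N} a x)" using pos[OF v] by simp
    then show ?thesis by (simp add: less_eq_complex_def)
  qed
  ultimately show ?thesis by (simp add: psd_def)
qed

text \<open>Rank one makes the principal \<open>2 \<times> 2\<close> minors vanish. Hence the Schur complement of a positive
  diagonal entry has zero diagonal, and being positive semidefinite it is zero.\<close>

lemma psd_rank_one_factor: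
  assumes A: "A \<in> carrier_mat N N" "vec_space.rank N A \<le> 1"
    and real: "\<And>i j. i < N \<Longrightarrow> j < N \<Longrightarrow> A $$ (i, j) = complex_of_real (a i j)"
    and a: "psd {..<N} a" and r: "\<And>i j. i < N \<Longrightarrow> j < N \<Longrightarrow> a i j \<in> {0..r}" "0 < r"
  shows "\<exists>u. (\<forall>k<N. u k \<in> {0..sqrt r}) \<and> (\<forall>j<N. \<forall>k<N. a j k = u j * u k)"
proof (cases "\<exists>i\<in>{..<N}. a i i > 0")
  case False
  then have "a j k = 0 * 0" if "j < N" "k < N" for j k
    using no_positive_diag_imp_zero[OF finite_lessThan a False] that by simp
  then show ?thesis using r(2) by (intro exI[of _ "\<lambda>_. 0"]) auto
next
  case True
  then obtain i where i: "i \<in> {..<N}" "a i i > 0" by blast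
  have sym: "a k i = a i k" if "k < N" for k using psd_sym[OF a, of k i] that i(1) by simp
  have minor: "a k k * a i i = a i k * a i k" if k: "k < N" for k
  proof (rule ccontr)
    assume ne: "a k k * a i i \<noteq> a i k * a i k"
    then have ik: "i \<noteq> k" by auto
    have "card {i, k} \<le> vec_space.rank N A"
    proof (rule rank_ge_nonsingular_block[OF A(1)])
      show "{i, k} \<subseteq> {..<N}" using i k by auto
      fix w l
      assume w: "\<And>j. j \<in> {i, k} \<Longrightarrow> (\<Sum>l\<in>{i, k}. A $$ (j, l) * w l) = 0" and l: "l \<in> {i, k}"
      define p where "p = complex_of_real (a i i)"
      define s where "s = complex_of_real (a i k)"
      define t where "t = complex_of_real (a k k)"
      have eqs: "p * w i + s * w k = 0" "s * w i + t * w k = 0"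
        using w[of i] w[of k] ik i(1) k real sym[OF k] by (simp_all add: p_def s_def t_def)
      have "t * p - s * s = complex_of_real (a k k * a i i - a i k * a i k)"
        by (simp add: p_def s_def t_def)
      then have det: "t * p - s * s \<noteq> 0" using ne by (metis of_real_eq_0_iff right_minus_eq)
      have "(t * p - s * s) * w i = t * (p * w i + s * w k) - s * (s * w i + t * w k)"
        "(t * p - s * s) * w k = p * (s * w i + t * w k) - s * (p * w i + s * w k)"
        by (simp_all add: algebra_simps)
      then show "w l = 0" using eqs det l by auto
    qed
    then show False using A(2) ik by simp
  qed
  define d where "d j k = a j k - a i j * a i k / a i i" for j k
  have d: "psd {..<N} d"
    unfolding d_def by (rule psd_schur_complement[OF finite_lessThan a i])
  have dz: "d j j = 0" if "j < N" for j
    using minor[OF that] i(2) by (simp add: d_def field_simps)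
  have "d j k = 0" if "j < N" "k < N" for j k
    by (rule psd_zero_diag[OF finite_lessThan d]) (use that dz in auto)
  then have "a j k = (a i j / sqrt (a i i)) * (a i k / sqrt (a i i))" if "j < N" "k < N" for j k
    using that rank_one_root[OF i(2), of "a i j" "a i k"] by (simp add: d_def)
  moreover have "a i j / sqrt (a i i) \<in> {0..sqrt r}" if "j < N" for j
    by (rule rank_one_root_range[OF finite_lessThan a i]) (use r that in auto)
  ultimately show ?thesis by (intro exI[of _ "\<lambda>j. a i j / sqrt (a i i)"] conjI allI impI)
qed

lemma setting_data:
  assumes "0 < r" and set: "setting1 N r n M P \<or> setting2 N r n M P \<or> setting3 N r n M P" and A: "A \<in> P"
  obtains a where "A \<in> carrier_mat N N" "\<And>i j. i < N \<Longrightarrow> j < N \<Longrightarrow> A $$ (i, j) = complex_of_real (a i j)"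
    "psd {..<N} a" "\<And>i j. i < N \<Longrightarrow> j < N \<Longrightarrow> a i j \<in> {0..r}" "regime N r n M a"
    "\<And>i j. i < N \<Longrightarrow> j < N \<Longrightarrow> a i j = 0 \<Longrightarrow> \<forall>j<N. 0 \<le> n j"
proof
  define a where "a i j = Re (A $$ (i, j))" for i j
  have mem: "(A \<in> psd_mats N 1 (complex_of_real ` {0<..<r}))
     \<or> (A \<in> psd_mats N 1 (complex_of_real ` {0..r}) \<and> (\<forall>j<N. 0 \<le> n j))
     \<or> (A \<in> psd_mats N N (complex_of_real ` {0..r}) \<and> (\<forall>j<N. admissible_exponent N (n j)) \<and> admissible_exponent N M)"
    using set A unfolding setting1_def setting2_def setting3_def admissible_exponent_def by blast
  then have psdA: "positive_semidefinite N A"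
    and "elements_mat A \<subseteq> complex_of_real ` {0<..<r} \<or> elements_mat A \<subseteq> complex_of_real ` {0..r}"
    unfolding psd_mats_def by blast+
  moreover have "complex_of_real ` {0<..<r} \<subseteq> complex_of_real ` {0..r}"
    by (rule image_mono) auto
  ultimately have el: "elements_mat A \<subseteq> complex_of_real ` {0..r}" by blast
  show car: "A \<in> carrier_mat N N" using psdA by (simp add: positive_semidefinite_def)
  have "A $$ (i, j) \<in> complex_of_real ` {0..r}" if "i < N" "j < N" for i j
    using elements_matI[OF car that refl] el by blast
  then show real: "A $$ (i, j) = complex_of_real (a i j)" and rng: "a i j \<in> {0..r}"
    if "i < N" "j < N" for i j
  proof -
    obtain x where "x \<in> {0..r}" "A $$ (i, j) = complex_of_real x"
      using \<open>\<And>i j. i < N \<Longrightarrow> j < N \<Longrightarrow> A $$ (i, j) \<in> complex_of_real ` {0..r}\<close>[OF \<open>i < N\<close> \<open>j < N\<close>] by blast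
    then show "A $$ (i, j) = complex_of_real (a i j)" "a i j \<in> {0..r}" by (simp_all add: a_def)
  qed
  show a: "psd {..<N} a" by (rule psd_of_matrix[OF psdA real])
  show zero: "\<forall>j<N. 0 \<le> n j" if "i < N" "j < N" "a i j = 0" for i j
    using mem
  proof (elim disjE conjE)
    assume "A \<in> psd_mats N 1 (complex_of_real ` {0<..<r})"
    then have "A $$ (i, j) \<in> complex_of_real ` {0<..<r}"
      using elements_matI[OF car that(1,2) refl] by (auto simp: psd_mats_def)
    then show ?thesis using that by (auto simp: a_def)
  next
    assume "\<forall>j<N. admissible_exponent N (n j)"
    then show ?thesis using that(1) admissible_exponent_nonneg by auto
  qed
  have "regime N r n M a" if rk: "vec_space.rank N A \<le> 1"
  proof -
    obtain u where u: "\<forall>k<N. u k \<in> {0..sqrt r}" "\<forall>j<N. \<forall>k<N. a j k = u j * u k"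
      using psd_rank_one_factor[OF car rk real a rng assms(1)] by blast
    have "\<forall>j<N. 0 \<le> n j" if "0 \<in> u ` {..<N}"
    proof -
      from that obtain k where "k < N" "u k = 0" by auto
      then show ?thesis using zero[of k k] u(2) by simp
    qed
    then show ?thesis unfolding regime_def using u by blast
  qed
  then show "regime N r n M a"
    using mem by (auto simp: psd_mats_def regime_def)
qed

lemma rank_fewnomial_image:
  assumes N: "2 \<le> N" and r: "0 < r" and n: "strict_mono_on {..<N} n" "n (N - 1) < M"
    and set: "setting1 N r n M P \<or> setting2 N r n M P \<or> setting3 N r n M P"
    and c: "\<forall>j<N. 0 < c j" and A: "A \<in> P"
    and zero_row: "(\<exists>i<N. \<forall>j<N. A $$ (i, j) = 0) \<longrightarrow> n 0 = 0"
    and q: "q * threshold N r n M c < 1 \<or> q * threshold N r n M c = 1 \<and>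
      (A \<notin> stratum N (singletons N) \<or>
       (\<exists>i<N. inj_on (\<lambda>j. A $$ (i, j)) {..<N} \<and> ((\<exists>j<N. A $$ (i, j) = 0) \<longrightarrow> n 0 = 0)))"
    and F: "\<And>z. F z = (\<Sum>j<N. complex_of_real (c j) * rpow z (n j)) - complex_of_real q * rpow z M"
  shows "vec_space.rank N (map_mat F A) = card (partition_of N A)"
proof -
  obtain a where car: "A \<in> carrier_mat N N"
    and real: "\<And>i j. i < N \<Longrightarrow> j < N \<Longrightarrow> A $$ (i, j) = complex_of_real (a i j)"
    and a: "regime N r n M a" "psd {..<N} a" "\<And>i j. i < N \<Longrightarrow> j < N \<Longrightarrow> a i j \<in> {0..r}"
    and zero: "\<And>i j. i < N \<Longrightarrow> j < N \<Longrightarrow> a i j = 0 \<Longrightarrow> \<forall>j<N. 0 \<le> n j"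
    by (rule setting_data[OF r set A]) blast
  have inj: "inj_on n {..<N}" using n(1) by (rule strict_mono_on_imp_inj_on)
  have bc: "block_constant N A (partition_of N A)"
    using minimal_partition_of by (simp add: minimal_block_constant_def)
  then have part: "partition_on {..<N} (partition_of N A)" by (simp add: block_constant_def)
  obtain R where R: "R \<subseteq> {..<N}" "card R = card (partition_of N A)"
    and one: "\<And>i k I. I \<in> partition_of N A \<Longrightarrow> i \<in> R \<inter> I \<Longrightarrow> k \<in> R \<inter> I \<Longrightarrow> i = k"
    and full: "card (partition_of N A) = N \<Longrightarrow> partition_of N A = singletons N"
    by (rule block_representatives[OF part]) blast
  have sep: "i = k" if "i \<in> R" "k \<in> R" "a i k = a i i" "a k k = a i i" for i k
  proof -
    have ik: "i < N" "k < N" using that R by auto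
    have "a l i = a l k \<and> a i l = a k l" if "l < N" for l
      using psd_equal_rows[OF finite_lessThan a(2), of i k l] psd_sym[OF a(2), of i l]
        psd_sym[OF a(2), of k l] ik that \<open>a i k = a i i\<close> \<open>a k k = a i i\<close> by simp
    then have "A $$ (i, l) = A $$ (k, l) \<and> A $$ (l, i) = A $$ (l, k)" if "l < N" for l
      using real ik that by simp
    note lines = this
    obtain I where I: "I \<in> partition_of N A" "i \<in> I"
      using part ik by (auto simp: partition_on_def)
    have "k \<in> I" using equal_lines_same_block[OF ik lines I] by simp
    then show ?thesis using one[OF I(1)] I(2) that(1,2) by blast
  qed
  have "card R \<le> vec_space.rank N (map_mat F A)"
  proof (rule rank_ge_definite_block[OF _ R(1)])
    show "map_mat F A \<in> carrier_mat N N" using car by simp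
    show "map_mat F A $$ (i, k) = complex_of_real (fewnomial {..<N} n c q M (a i k))"
      if "i \<in> R" "k \<in> R" for i k
    proof -
      have ik: "i < N" "k < N" using that R by auto
      then have "0 \<le> a i k" using a(3) by auto
      then show ?thesis using car ik
        by (simp add: real F fewnomial_def rpow_of_real)
    qed
    fix v k
    assume form0: "qform R (\<lambda>i k. fewnomial {..<N} n c q M (a i k)) v = 0" and k: "k \<in> R"
    show "v k = 0"
    proof (rule fewnomial_form_definite[OF N r n _ a zero _ R(1) sep _ form0 k])
      show "n 0 = 0" if "j < N" "a j j = 0" for j
      proof -
        have "A $$ (j, k) = 0" if "k < N" for k
          using psd_zero_diag[OF finite_lessThan a(2), of j k] \<open>j < N\<close> \<open>a j j = 0\<close> that real by simp
        then show ?thesis using zero_row that(1) by blast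
      qed
      show "q * sharp_const {..<N} n M c r < 1 \<or> q * sharp_const {..<N} n M c r = 1 \<and>
        (card R < N \<or> (\<exists>i<N. inj_on (a i) {..<N} \<and> ((\<exists>k<N. a i k = 0) \<longrightarrow> n 0 = 0)))"
        using q unfolding threshold_eq[OF inj]
      proof (elim disjE conjE exE)
        assume "A \<notin> stratum N (singletons N)" and q1: "q * sharp_const {..<N} n M c r = 1"
        then have "card R \<noteq> N" using full R(2) car by (auto simp: stratum_def)
        moreover have "card R \<le> N" using card_mono[OF finite_lessThan R(1)] by simp
        ultimately show ?thesis using q1 by simp
      next
        fix i assume q1: "q * sharp_const {..<N} n M c r = 1" and i: "i < N"
          "inj_on (\<lambda>j. A $$ (i, j)) {..<N}" "(\<exists>j<N. A $$ (i, j) = 0) \<longrightarrow> n 0 = 0"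
        have "inj_on (a i) {..<N}" using i(1,2) real by (auto simp: inj_on_def)
        moreover have "(\<exists>k<N. a i k = 0) \<longrightarrow> n 0 = 0" using i(1,3) real by auto
        ultimately show ?thesis using q1 i(1) by blast
      qed simp
    qed (use c in auto)
  qed
  moreover have "vec_space.rank N (map_mat F A) \<le> card (partition_of N A)"
    by (rule rank_le_blocks[OF car bc])
  ultimately show ?thesis using R(2) by simp
qed

lemma threshold_pos:
  assumes "0 < N" "0 < r" "strict_mono_on {..<N} n" "n (N - 1) < M" "\<forall>j<N. 0 < c j"
  shows "0 < threshold N r n M c"
proof -
  have inj: "inj_on n {..<N}" using assms(3) by (rule strict_mono_on_imp_inj_on)
  have "n j < M" if "j < N" for j
  proof (cases "j = N - 1")
    case False
    then have "n j < n (N - 1)" using that by (intro strict_mono_onD[OF assms(3)]) auto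
    then show ?thesis using assms(4) by simp
  qed (use assms(4) in simp)
  then show ?thesis unfolding threshold_eq[OF inj]
    using assms inj by (intro sharp_const_pos) (auto simp: lessThan_empty_iff)
qed

theorem theorem3p7:
  fixes N :: nat and \<rho> M c' C :: real and n c :: "nat \<Rightarrow> real"
    and P0 :: "complex mat set" and h f g :: "complex \<Rightarrow> complex" and A :: "complex mat"
  assumes "N \<ge> 2" and "\<rho> > 0"
    and "strict_mono_on {..<N} n" and "n (N - 1) < M"
    and "setting1 N \<rho> n M P0 \<or> setting2 N \<rho> n M P0 \<or> setting3 N \<rho> n M P0"
    and "\<forall>j<N. c j > 0"
    and "C = threshold N \<rho> n M c"
    and "c' > - inverse C"
    and "h = (\<lambda>z. \<Sum>j<N. complex_of_real (c j) * rpow z (n j))"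
    and "f = (\<lambda>z. h z + complex_of_real c' * rpow z M)"
    and "g = (\<lambda>z. h z - complex_of_real (inverse C) * rpow z M)"
    and "A \<in> P0"
    and "(\<exists>i<N. \<forall>j<N. A $$ (i, j) = 0) \<longrightarrow> n 0 = 0"
  shows "vec_space.rank N (map_mat f A) = card (partition_of N A)
    \<and> vec_space.rank N (map_mat h A) = card (partition_of N A)
    \<and> (A \<notin> stratum N (singletons N)
       \<or> A \<in> stratum N (singletons N)
         \<and> (\<exists>i<N. inj_on (\<lambda>j. A $$ (i, j)) {..<N}
                 \<and> ((\<exists>j<N. A $$ (i, j) = 0) \<longrightarrow> n 0 = 0))
       \<longrightarrow> vec_space.rank N (map_mat g A) = card (partition_of N A))"
proof -
  note rank = rank_fewnomial_image[OF assms(1-6,12,13)]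
  have C: "0 < C" unfolding assms(7) using assms by (intro threshold_pos) auto
  have "- c' * C < inverse C * C" using assms(8) C by (intro mult_strict_right_mono) auto
  then have f: "vec_space.rank N (map_mat f A) = card (partition_of N A)"
    using C assms(7,9,10) by (intro rank[where q = "- c'"]) auto
  have h: "vec_space.rank N (map_mat h A) = card (partition_of N A)"
    using assms(9) by (intro rank[where q = 0]) auto
  have g: "vec_space.rank N (map_mat g A) = card (partition_of N A)"
    if "A \<notin> stratum N (singletons N) \<or> A \<in> stratum N (singletons N)
      \<and> (\<exists>i<N. inj_on (\<lambda>j. A $$ (i, j)) {..<N} \<and> ((\<exists>j<N. A $$ (i, j) = 0) \<longrightarrow> n 0 = 0))"
    using C assms(7,9,11) that by (intro rank[where q = "inverse C"]) auto
  show ?thesis using f g h by blast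
qed

end
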